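(* The uniformity of $1$-genericity to $2$-randomness is $2$. That is, with $\mathcal{A}$ the class of $1$-generic sets and $\mathcal{B}$ the class of $2$-random sets, we have $\mathcal{A}\leq_2\mathcal{B}$, but $\mathcal{A}\not\leq_0\mathcal{B}$ and $\mathcal{A}\not\leq_1\mathcal{B}$.
   Context: $\Phi_e$ is the Turing functional with index $e$; writing $\Phi_e(f)\in\mathcal{A}$ means in particular that $\Phi_e(f)$ is total. $\Pi^0_n$-classes are the effective (lightface) $\Pi^0_n$ subsets of $\omega^\omega$; a sequence of classes is uniformly $\Pi^0_n$ if it has a computable sequence of $\Pi^0_n$-indices. For $n=0$, $\Pi^0_0$-classes are finite Boolean combinations of cylinders $\{f \mid \sigma\subset f\}$, $\sigma\in\omega^{<\omega}$. For $n\in\omega$ and $\mathcal{A},\mathcal{B}\subseteq\omega^\omega$, $\mathcal{A}\leq_n\mathcal{B}$ means: there are a uniformly $\Pi^0_n$ sequence $\mathcal{V}_0,\mathcal{V}_1,\dots$ with $\mathcal{B}\subseteq\bigcup_i\mathcal{V}_i$ and a computable sequence $e_0,e_1,\dots$ such that for every $i$ and every $f\in\mathcal{B}\cap\mathcal{V}_i$ we have $\Phi_{e_i}(f)\in\mathcal{A}$. $\leq_\omega$ denotes Muchnik reducibility (every $f\in\mathcal{B}$ computes some $g\in\mathcal{A}$). If $\mathcal{A}$ Muchnik-reduces to $\mathcal{B}$, the uniformity of $\mathcal{A}$ to $\mathcal{B}$ is the least $n\in\omega+1$ with $\mathcal{A}\leq_n\mathcal{B}$. A set $X\in2^\omega$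 is $2$-random if it is Martin-Löf random relative to $\emptyset'$. A set $X\in 2^\omega$ is $1$-generic if for every c.e. set $W\subseteq2^{<\omega}$ there is a $k$ such that either $X\restriction k\in W$ or no $\tau\supseteq X\restriction k$ is in $W$. *)

theory Defs
  imports
    "HOL-Probability.Probability"
    "HOL-Library.Nat_Bijection"
    "HOL-Library.Sublist"
    "HOL-Library.Extended_Nat"
begin

text \<open>
  Oracle computability is set up through the usual unary presentation of the partial recursive
  functions, with several arguments combined by \<^const>\<open>prod_encode\<close> and finite strings
  represented by \<^const>\<open>list_encode\<close>. Elements of Cantor space are the functions
  \<^typ>\<open>nat \<Rightarrow> nat\<close> with values in \<open>{0, 1}\<close>, so Cantor space is a subset of Baire space.
\<close>

section \<open>Turing functionals\<close>

datatype code =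
    Zero | Succ | Left | Right | Oracle
  | Pairing code code | Comp code code | Prec code code | Mu code

primrec eval :: "code \<Rightarrow> (nat \<Rightarrow> nat) \<Rightarrow> nat \<Rightarrow> nat option" where
  "eval Zero f x = Some 0"
| "eval Succ f x = Some (Suc x)"
| "eval Left f x = Some (fst (prod_decode x))"
| "eval Right f x = Some (snd (prod_decode x))"
| "eval Oracle f x = Some (f x)"
| "eval (Pairing c d) f x =
     Option.bind (eval c f x) (\<lambda>a. Option.bind (eval d f x) (\<lambda>b. Some (prod_encode (a, b))))"
| "eval (Comp c d) f x = Option.bind (eval d f x) (eval c f)"
| "eval (Prec c d) f x =
     (let a = fst (prod_decode x); n = snd (prod_decode x)
      in rec_nat (eval c f a)
           (\<lambda>m r. Option.bind r (\<lambda>b. eval d f (prod_encode (a, prod_encode (m, b))))) n)"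
| "eval (Mu c) f x =
     (if \<exists>n. eval c f (prod_encode (x, n)) = Some 0 \<and>
             (\<forall>m<n. eval c f (prod_encode (x, m)) \<noteq> None)
      then Some (LEAST n. eval c f (prod_encode (x, n)) = Some 0)
      else None)"

lemma fst_prod_decode_le: "fst (prod_decode n) \<le> n"
  by (metis le_prod_encode_1 prod.collapse prod_decode_inverse)

lemma snd_prod_decode_le: "snd (prod_decode n) \<le> n"
  by (metis le_prod_encode_2 prod.collapse prod_decode_inverse)

function (sequential) code_of :: "nat \<Rightarrow> code" where
  "code_of 0 = Zero"
| "code_of (Suc 0) = Succ"
| "code_of (Suc (Suc 0)) = Left"
| "code_of (Suc (Suc (Suc 0))) = Right"
| "code_of (Suc (Suc (Suc (Suc 0)))) = Oracle"
| "code_of (Suc (Suc (Suc (Suc (Suc n))))) =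
     (let m = n div 4; a = fst (prod_decode m); b = snd (prod_decode m)
      in if n mod 4 = 0 then Pairing (code_of a) (code_of b)
         else if n mod 4 = 1 then Comp (code_of a) (code_of b)
         else if n mod 4 = 2 then Prec (code_of a) (code_of b)
         else Mu (code_of m))"
  by pat_completeness (simp_all only: nat.inject nat.distinct old.nat.distinct)
termination
proof -
  have le: "fst (prod_decode (n div 4)) \<le> n" "snd (prod_decode (n div 4)) \<le> n" for n :: nat
    using fst_prod_decode_le[of "n div 4"] snd_prod_decode_le[of "n div 4"]
      div_le_dividend[of n 4] by linarith+
  have lt: "m < Suc (Suc (Suc (Suc (Suc n))))" if "m \<le> n" for m n :: nat
    using that by simp
  show ?thesis
    by (relation "Wellfounded.measure id") (simp_all only: in_measure id_apply wf_measure lt le div_le_dividend)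
qed

lemma surj_code_of: "surj code_of"
proof -
  have ex: "\<exists>n. n div 4 = p \<and> n mod 4 = k" if "k < 4" for p k :: nat
    using that by (intro exI[of _ "4 * p + k"]) simp
  have "\<exists>n. code_of n = c" for c
  proof (induction c)
    case Zero show ?case by (rule exI[of _ 0]) simp
  next
    case Succ show ?case by (rule exI[of _ "Suc 0"]) simp
  next
    case Left show ?case by (rule exI[of _ "Suc (Suc 0)"]) simp
  next
    case Right show ?case by (rule exI[of _ "Suc (Suc (Suc 0))"]) simp
  next
    case Oracle show ?case by (rule exI[of _ "Suc (Suc (Suc (Suc 0)))"]) simp
  next
    case (Pairing c d)
    then obtain a b where ab: "code_of a = c" "code_of b = d" by blast
    obtain n where "n div 4 = prod_encode (a, b)" "n mod 4 = 0" using ex[of 0 "prod_encode (a, b)"] by auto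
    with ab have "code_of (Suc (Suc (Suc (Suc (Suc n))))) = Pairing c d" by simp
    then show ?case by blast
  next
    case (Comp c d)
    then obtain a b where ab: "code_of a = c" "code_of b = d" by blast
    obtain n where "n div 4 = prod_encode (a, b)" "n mod 4 = 1" using ex[of 1 "prod_encode (a, b)"] by auto
    with ab have "code_of (Suc (Suc (Suc (Suc (Suc n))))) = Comp c d" by simp
    then show ?case by blast
  next
    case (Prec c d)
    then obtain a b where ab: "code_of a = c" "code_of b = d" by blast
    obtain n where "n div 4 = prod_encode (a, b)" "n mod 4 = 2" using ex[of 2 "prod_encode (a, b)"] by auto
    with ab have "code_of (Suc (Suc (Suc (Suc (Suc n))))) = Prec c d" by simp
    then show ?case by blast
  next
    case (Mu c)
    then obtain a where a: "code_of a = c" by blast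
    obtain n where "n div 4 = a" "n mod 4 = 3" using ex[of 3 a] by auto
    with a have "code_of (Suc (Suc (Suc (Suc (Suc n))))) = Mu c" by simp
    then show ?case by blast
  qed
  then show ?thesis by (metis surjI)
qed

definition Phi :: "nat \<Rightarrow> (nat \<Rightarrow> nat) \<Rightarrow> nat \<Rightarrow> nat option" where
  "Phi e f = eval (code_of e) f"

text \<open>\<open>Phi_in e f A\<close> says that the functional with index \<open>e\<close> is total on \<open>f\<close>, with value in \<open>A\<close>.\<close>

definition Phi_in :: "nat \<Rightarrow> (nat \<Rightarrow> nat) \<Rightarrow> (nat \<Rightarrow> nat) set \<Rightarrow> bool" where
  "Phi_in e f A \<longleftrightarrow> (\<exists>g\<in>A. \<forall>x. Phi e f x = Some (g x))"

definition no_oracle :: "nat \<Rightarrow> nat" where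
  "no_oracle = (\<lambda>_. 0)"

definition computable :: "(nat \<Rightarrow> nat) \<Rightarrow> bool" where
  "computable h \<longleftrightarrow> (\<exists>e. \<forall>x. Phi e no_oracle x = Some (h x))"

definition W_rel :: "(nat \<Rightarrow> nat) \<Rightarrow> nat \<Rightarrow> nat set" where
  "W_rel f e = {x. Phi e f x \<noteq> None}"

definition halting_set :: "nat set" where
  "halting_set = {e. Phi e no_oracle e \<noteq> None}"

definition halting_oracle :: "nat \<Rightarrow> nat" where
  "halting_oracle x = (if x \<in> halting_set then 1 else 0)"

section \<open>Effective classes in Baire space\<close>

definition restr :: "(nat \<Rightarrow> nat) \<Rightarrow> nat \<Rightarrow> nat list" where
  "restr f k = map f [0..<k]"

definition cylinder :: "nat list \<Rightarrow> (nat \<Rightarrow> nat) set" where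
  "cylinder \<sigma> = {f. restr f (length \<sigma>) = \<sigma>}"

datatype clopen_expr = Cyl "nat list" | Neg clopen_expr | Conj clopen_expr clopen_expr

primrec clopen_sem :: "clopen_expr \<Rightarrow> (nat \<Rightarrow> nat) set" where
  "clopen_sem (Cyl \<sigma>) = cylinder \<sigma>"
| "clopen_sem (Neg b) = - clopen_sem b"
| "clopen_sem (Conj b c) = clopen_sem b \<inter> clopen_sem c"

function clopen_of :: "nat \<Rightarrow> clopen_expr" where
  "clopen_of n =
     (let m = n div 3
      in if n mod 3 = 0 then Cyl (list_decode m)
         else if n mod 3 = 1 then Neg (clopen_of m)
         else Conj (clopen_of (fst (prod_decode m))) (clopen_of (snd (prod_decode m))))"
  by pat_completeness auto
termination
proof -
  have lt: "n div 3 < n" if "n mod 3 \<noteq> 0" for n :: nat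
    using that by (cases "n = 0") simp_all
  note lt_fst = le_less_trans[OF fst_prod_decode_le lt]
  note lt_snd = le_less_trans[OF snd_prod_decode_le lt]
  show ?thesis
    by (relation "Wellfounded.measure id")
       (simp_all only: in_measure id_apply wf_measure lt lt_fst lt_snd not_False_eq_True)
qed

declare clopen_of.simps [simp del]

lemma surj_clopen_of: "surj clopen_of"
proof -
  have "\<exists>n. clopen_of n = b" for b
  proof (induction b)
    case (Cyl \<sigma>)
    have "clopen_of (3 * list_encode \<sigma>) = Cyl \<sigma>"
      by (subst clopen_of.simps) (simp add: Let_def)
    then show ?case by blast
  next
    case (Neg b)
    then obtain a where a: "clopen_of a = b" by blast
    have "(3 * a + 1) div 3 = a" "(3 * a + 1) mod 3 = 1" by presburger+
    with a have "clopen_of (3 * a + 1) = Neg b"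
      by (subst clopen_of.simps) (simp only: Let_def, simp)
    then show ?case by blast
  next
    case (Conj b c)
    then obtain x y where xy: "clopen_of x = b" "clopen_of y = c" by blast
    have "(3 * prod_encode (x, y) + 2) div 3 = prod_encode (x, y)"
      "(3 * prod_encode (x, y) + 2) mod 3 = 2" by presburger+
    with xy have "clopen_of (3 * prod_encode (x, y) + 2) = Conj b c"
      by (subst clopen_of.simps) (simp only: Let_def, simp)
    then show ?case by blast
  qed
  then show ?thesis by (metis surjI)
qed

text \<open>
  \<open>Pi_class n e\<close> is the \<open>\<Pi>\<^sup>0\<^sub>n\<close> class with index \<open>e\<close>. A \<open>\<Sigma>\<^sup>0\<^sub>n\<^sub>+\<^sub>1\<close> class is the union of the
  \<open>\<Pi>\<^sup>0\<^sub>n\<close> classes whose indices form a c.e. set, and the \<open>\<Pi>\<^sup>0\<^sub>n\<^sub>+\<^sub>1\<close> classes are the complements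
  of these.
\<close>

primrec Pi_class :: "nat \<Rightarrow> nat \<Rightarrow> (nat \<Rightarrow> nat) set" where
  "Pi_class 0 e = clopen_sem (clopen_of e)"
| "Pi_class (Suc n) e = - (\<Union>i\<in>W_rel no_oracle e. Pi_class n i)"

definition uniformly_Pi :: "nat \<Rightarrow> (nat \<Rightarrow> (nat \<Rightarrow> nat) set) \<Rightarrow> bool" where
  "uniformly_Pi n V \<longleftrightarrow> (\<exists>v. computable v \<and> (\<forall>i. V i = Pi_class n (v i)))"

section \<open>Reducibilities and uniformity\<close>

definition uniform_reducible ::
    "nat \<Rightarrow> (nat \<Rightarrow> nat) set \<Rightarrow> (nat \<Rightarrow> nat) set \<Rightarrow> bool" where
  "uniform_reducible n A B \<longleftrightarrow>
     (\<exists>V e. uniformly_Pi n V \<and> B \<subseteq> (\<Union>i. V i) \<and> computable e \<and>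
            (\<forall>i. \<forall>f\<in>B \<inter> V i. Phi_in (e i) f A))"

definition muchnik_reducible :: "(nat \<Rightarrow> nat) set \<Rightarrow> (nat \<Rightarrow> nat) set \<Rightarrow> bool" where
  "muchnik_reducible A B \<longleftrightarrow> (\<forall>f\<in>B. \<exists>e. Phi_in e f A)"

text \<open>The type \<^typ>\<open>enat\<close> plays the role of \<open>\<omega> + 1\<close>, with \<open>\<infinity>\<close> for \<open>\<omega>\<close>.\<close>

definition reducible :: "enat \<Rightarrow> (nat \<Rightarrow> nat) set \<Rightarrow> (nat \<Rightarrow> nat) set \<Rightarrow> bool" where
  "reducible k A B =
     (case k of enat n \<Rightarrow> uniform_reducible n A B | \<infinity> \<Rightarrow> muchnik_reducible A B)"

text \<open>Only meaningful when \<open>muchnik_reducible A B\<close> holds.\<close>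

definition uniformity :: "(nat \<Rightarrow> nat) set \<Rightarrow> (nat \<Rightarrow> nat) set \<Rightarrow> enat" where
  "uniformity A B = (LEAST k. reducible k A B)"

section \<open>Genericity and randomness\<close>

definition cantor :: "(nat \<Rightarrow> nat) set" where
  "cantor = {X. range X \<subseteq> {0, 1}}"

definition binary_strings :: "nat list set" where
  "binary_strings = {\<sigma>. set \<sigma> \<subseteq> {0, 1}}"

definition ce_strings :: "nat list set \<Rightarrow> bool" where
  "ce_strings S \<longleftrightarrow> (\<exists>e. list_encode ` S = W_rel no_oracle e)"

definition one_generic :: "(nat \<Rightarrow> nat) set" where
  "one_generic =
     {X \<in> cantor. \<forall>S. S \<subseteq> binary_strings \<and> ce_strings S \<longrightarrow>
        (\<exists>k. restr X k \<in> S \<or> \<not> (\<exists>\<tau>\<in>S. prefix (restr X k) \<tau>))}"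

text \<open>
  The fair coin measure, carried by Baire space but concentrated on Cantor space.
\<close>

definition coin_measure :: "(nat \<Rightarrow> nat) measure" where
  "coin_measure = PiM UNIV (\<lambda>_. measure_pmf (pmf_of_set {0, 1}))"

definition open_generated :: "nat list set \<Rightarrow> (nat \<Rightarrow> nat) set" where
  "open_generated S = {X \<in> cantor. \<exists>\<sigma>\<in>S. X \<in> cylinder \<sigma>}"

definition martin_loef_test :: "(nat \<Rightarrow> nat) \<Rightarrow> (nat \<Rightarrow> (nat \<Rightarrow> nat) set) \<Rightarrow> bool" where
  "martin_loef_test f U \<longleftrightarrow>
     (\<exists>e. \<forall>n. U n = open_generated {\<sigma>. prod_encode (n, list_encode \<sigma>) \<in> W_rel f e}) \<and>
     (\<forall>n. measure coin_measure (U n) \<le> (1 / 2) ^ n)"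

definition martin_loef_random :: "(nat \<Rightarrow> nat) \<Rightarrow> (nat \<Rightarrow> nat) set" where
  "martin_loef_random f = {X \<in> cantor. \<forall>U. martin_loef_test f U \<longrightarrow> X \<notin> (\<Inter>n. U n)}"

definition two_random :: "(nat \<Rightarrow> nat) set" where
  "two_random = martin_loef_random halting_oracle"

text \<open>Measurability, so that the bound in \<^const>\<open>martin_loef_test\<close> is never about a non-measurable set.\<close>

lemma space_coin_measure: "space coin_measure = UNIV"
  by (simp add: coin_measure_def space_PiM PiE_UNIV_domain)

lemma coordinate_sets: "{X. P (X i)} \<in> sets coin_measure"
proof -
  have "(\<lambda>X. X i) \<in> measurable coin_measure (measure_pmf (pmf_of_set {0, 1}))"
    unfolding coin_measure_def by (rule measurable_component_singleton) simp
  then have "(\<lambda>X. X i) -` {y. P y} \<inter> space coin_measure \<in> sets coin_measure"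
    by (rule measurable_sets) simp
  then show ?thesis
    by (simp add: space_coin_measure vimage_def)
qed

lemma cylinder_sets: "cylinder \<sigma> \<in> sets coin_measure"
proof -
  have "cylinder \<sigma> = {X. \<forall>i. i < length \<sigma> \<longrightarrow> X i = \<sigma> ! i}"
    unfolding cylinder_def restr_def list_eq_iff_nth_eq by simp
  also have "\<dots> = (\<Inter>i. {X. i < length \<sigma> \<longrightarrow> X i = \<sigma> ! i})"
    by blast
  also have "\<dots> \<in> sets coin_measure"
    by (intro sets.countable_INT UNIV_not_empty image_subsetI
          coordinate_sets[where P = "\<lambda>y. i < length \<sigma> \<longrightarrow> y = \<sigma> ! i" for i])
  finally show ?thesis .
qed

lemma cantor_sets: "cantor \<in> sets coin_measure"
proof -
  have "cantor = (\<Inter>i. {X. X i \<in> {0, 1}})"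
    by (simp add: cantor_def image_subset_iff set_eq_iff)
  also have "\<dots> \<in> sets coin_measure"
    by (intro sets.countable_INT UNIV_not_empty image_subsetI coordinate_sets[where P = "\<lambda>y. y \<in> {0, 1}"])
  finally show ?thesis .
qed

lemma open_generated_sets: "open_generated S \<in> sets coin_measure"
proof -
  have "open_generated S = cantor \<inter> (\<Union>\<sigma>\<in>S. cylinder \<sigma>)"
    unfolding open_generated_def by blast
  moreover have "(\<Union>\<sigma>\<in>S. cylinder \<sigma>) \<in> sets coin_measure"
    by (rule sets.countable_UN') (simp_all add: cylinder_sets image_subset_iff)
  ultimately show ?thesis
    using cantor_sets by (simp add: sets.Int)
qed

end

theory Submission imports Defs begin

text \<open>
  No reduction through closed sets. Suppose \<open>V\<close> is \<open>\<Pi>\<^sup>0\<^sub>1\<close> of positive measure and \<open>\<Phi>\<close> maps the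
  2-random elements of \<open>V\<close> to 1-generic sets, so that \<open>\<Phi>\<close> is total almost everywhere on \<open>V\<close>. Then
  every string \<open>\<sigma>\<close> has an extension \<open>\<tau>\<close>, found effectively, such that the part of \<open>V\<close> which \<open>\<Phi>\<close> maps
  above \<open>\<tau>\<close> is as small as we like: wait until \<open>\<Phi>\<close> has produced enough output on almost all of the
  current approximation to \<open>V\<close>. These \<open>\<tau>\<close> form a dense c.e. set which a positive fraction of the
  outputs avoids.

  The reduction. For each requirement \<open>e\<close> a block of \<open>e + i + 1\<close> bits of \<open>X\<close> encodes a guess \<open>\<kappa>\<close>. We
  extend the output while believing that the string recorded for \<open>e\<close> has no extension in \<open>W\<^sub>e\<close>.
  Whenever this proves wrong we record the current output instead, except that at the error with
  number \<open>\<kappa>\<close> we wait for an extension of the current output in \<open>W\<^sub>e\<close> and take it. Since guesses are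
  finite, the result is 1-generic unless we wait forever. For fixed bits outside the block at most one
  guess waits forever, so this happens with probability at most \<open>2\<close> to the power \<open>-(e + i + 1)\<close>. In
  total the \<open>i\<close>-th functional fails on a set of measure at most \<open>2\<close> to the power \<open>-i\<close>; these sets are
  uniformly open and c.e. in the halting problem, hence form a test that 2-random sets pass.
\<close>

section \<open>Pairing of numbers and its projections\<close>

definition pl :: "nat \<Rightarrow> nat" where "pl z = fst (prod_decode z)"
definition pr :: "nat \<Rightarrow> nat" where "pr z = snd (prod_decode z)"
abbreviation pp :: "nat \<Rightarrow> nat \<Rightarrow> nat" where "pp a b \<equiv> prod_encode (a, b)"

lemma pl_pp [simp]: "pl (pp a b) = a" and pr_pp [simp]: "pr (pp a b) = b"
  by (simp_all add: pl_def pr_def)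

lemma pp_pl_pr [simp]: "pp (pl z) (pr z) = z"
  by (simp add: pl_def pr_def)

lemma le_pp1: "a \<le> pp a b" and le_pp2: "b \<le> pp a b"
  by (rule le_prod_encode_1, rule le_prod_encode_2)

section \<open>Total computable functionals\<close>

text \<open>One code has to work for every oracle and to halt on every input. This total,
  oracle-uniform notion is closed under all the bounded constructions below; unbounded search is
  kept apart in \<open>mu_search\<close>.\<close>

definition cpt :: "((nat \<Rightarrow> nat) \<Rightarrow> nat \<Rightarrow> nat) \<Rightarrow> bool" where
  "cpt F \<longleftrightarrow> (\<exists>c. \<forall>f x. eval c f x = Some (F f x))"

definition dec :: "((nat \<Rightarrow> nat) \<Rightarrow> nat \<Rightarrow> bool) \<Rightarrow> bool" where
  "dec P \<longleftrightarrow> cpt (\<lambda>f x. if P f x then 1 else 0)"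

definition cptl :: "((nat \<Rightarrow> nat) \<Rightarrow> nat \<Rightarrow> nat list) \<Rightarrow> bool" where
  "cptl L \<longleftrightarrow> cpt (\<lambda>f x. list_encode (L f x))"

text \<open>Closure rules that read computability off the shape of a term, by
  \<open>intro cpt\<close>. A bound variable of a sum, quantifier or table enters a rule as the
  second component of a pair, hence the many \<open>pl z\<close> and \<open>pr z\<close>.\<close>

named_theorems cpt

lemma cpt_id [cpt]: "cpt (\<lambda>f x. x)"
  unfolding cpt_def by (rule exI[of _ "Pairing Left Right"]) simp

lemma cpt_comp:
  assumes "cpt F" "cpt A" shows "cpt (\<lambda>f x. F f (A f x))"
proof -
  from assms obtain c d where "\<And>f x. eval c f x = Some (F f x)" "\<And>f x. eval d f x = Some (A f x)"
    unfolding cpt_def by blast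
  then have "\<forall>f x. eval (Comp c d) f x = Some (F f (A f x))" by simp
  then show ?thesis unfolding cpt_def by blast
qed

lemma cpt_prim:
  shows "cpt (\<lambda>f. pl)" "cpt (\<lambda>f. pr)" "cpt (\<lambda>f. Suc)" "cpt (\<lambda>f. f)" "cpt (\<lambda>f x. 0)"
  unfolding cpt_def
  by (rule exI[of _ Left], simp add: pl_def, rule exI[of _ Right], simp add: pr_def,
      rule exI[of _ Succ], simp, rule exI[of _ Oracle], simp, rule exI[of _ Zero], simp)

lemma cpt_pl [cpt]: "cpt A \<Longrightarrow> cpt (\<lambda>f x. pl (A f x))"
  by (rule cpt_comp[OF cpt_prim(1)])
lemma cpt_pr [cpt]: "cpt A \<Longrightarrow> cpt (\<lambda>f x. pr (A f x))"
  by (rule cpt_comp[OF cpt_prim(2)])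
lemma cpt_Suc [cpt]: "cpt A \<Longrightarrow> cpt (\<lambda>f x. Suc (A f x))"
  by (rule cpt_comp[OF cpt_prim(3)])
lemma cpt_oracle: "cpt A \<Longrightarrow> cpt (\<lambda>f x. f (A f x))"
  by (rule cpt_comp[OF cpt_prim(4)])

lemma cpt_const [cpt]: "cpt (\<lambda>f x. k)"
  by (induction k) (auto intro: cpt_prim cpt_Suc)

lemma cpt_pp [cpt]:
  assumes "cpt A" "cpt B" shows "cpt (\<lambda>f x. pp (A f x) (B f x))"
proof -
  from assms obtain c d where "\<And>f x. eval c f x = Some (A f x)" "\<And>f x. eval d f x = Some (B f x)"
    unfolding cpt_def by blast
  then have "\<forall>f x. eval (Pairing c d) f x = Some (pp (A f x) (B f x))" by simp
  then show ?thesis unfolding cpt_def by blast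
qed

lemma cpt_app2:
  assumes "cpt (\<lambda>f z. F f (pl z) (pr z))" "cpt A" "cpt B"
  shows "cpt (\<lambda>f x. F f (A f x) (B f x))"
  using cpt_comp[OF assms(1) cpt_pp[OF assms(2,3)]] by simp

text \<open>The whole input is carried as the parameter of \<open>Prec\<close>, so the base, the
  step function and the bound may all depend on it.\<close>

lemma cpt_rec:
  assumes "cpt A" "cpt (\<lambda>f z. D f (pl z) (pl (pr z)) (pr (pr z)))" "cpt N"
  shows "cpt (\<lambda>f x. rec_nat (A f x) (D f x) (N f x))"
proof -
  from assms obtain c d where c: "\<And>f x. eval c f x = Some (A f x)"
    and d: "\<And>f z. eval d f z = Some (D f (pl z) (pl (pr z)) (pr (pr z)))"
    unfolding cpt_def by blast
  have r: "rec_nat (Some (A f a)) (\<lambda>m r. Option.bind r (\<lambda>b. eval d f (pp a (pp m b)))) n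
      = Some (rec_nat (A f a) (D f a) n)" for f a n
    by (induction n) (simp_all add: d)
  have "\<forall>f x. eval (Prec c d) f x = Some (rec_nat (A f (pl x)) (D f (pl x)) (pr x))"
    by (simp add: c r Let_def flip: pl_def pr_def)
  then have "cpt (\<lambda>f x. rec_nat (A f (pl x)) (D f (pl x)) (pr x))"
    unfolding cpt_def by blast
  from cpt_app2[of "\<lambda>f x n. rec_nat (A f x) (D f x) n", OF this cpt_id assms(3)] show ?thesis .
qed

lemma cpt_cong: "cpt F \<Longrightarrow> (\<And>f x. F f x = G f x) \<Longrightarrow> cpt G"
  unfolding cpt_def by simp

lemma cpt_add [cpt]:
  assumes "cpt A" "cpt B" shows "cpt (\<lambda>f x. A f x + B f x)"
proof -
  have "rec_nat a (\<lambda>m r. Suc r) b = a + b" for a b :: nat by (induction b) auto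
  then show ?thesis
    using cpt_rec[OF assms(1) _ assms(2), of "\<lambda>f x m r. Suc r"] by (simp add: cpt_prim cpt_id cpt_pr cpt_Suc)
qed

lemma cpt_mult [cpt]:
  assumes "cpt A" "cpt B" shows "cpt (\<lambda>f x. A f x * B f x)"
proof -
  have "rec_nat 0 (\<lambda>m r. r + a) b = a * b" for a b :: nat by (induction b) auto
  moreover have "cpt (\<lambda>f z. pr (pr z) + A f (pl z))"
    by (intro cpt cpt_comp[OF assms(1)])
  ultimately show ?thesis
    using cpt_rec[OF cpt_const[of 0] _ assms(2), of "\<lambda>f x m r. r + A f x"] by simp
qed

lemma cpt_power [cpt]:
  assumes "cpt A" "cpt B" shows "cpt (\<lambda>f x. A f x ^ B f x)"
proof -
  have "rec_nat (Suc 0) (\<lambda>m r. r * a) b = a ^ b" for a b :: nat by (induction b) auto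
  moreover have "cpt (\<lambda>f z. pr (pr z) * A f (pl z))"
    by (intro cpt cpt_comp[OF assms(1)])
  ultimately show ?thesis
    using cpt_rec[OF cpt_const[of "Suc 0"] _ assms(2), of "\<lambda>f x m r. r * A f x"] by simp
qed

lemma cpt_diff [cpt]:
  assumes "cpt A" "cpt B" shows "cpt (\<lambda>f x. A f x - B f x)"
proof -
  \<comment> \<open>The predecessor arises from a recursion that drops its previous value and
    returns its counter.\<close>
  have 1: "rec_nat 0 (\<lambda>m r. m) a = a - 1" for a :: nat by (induction a) auto
  have p: "cpt C \<Longrightarrow> cpt (\<lambda>f x. C f x - 1)" for C
    using cpt_rec[OF cpt_const[of 0], of "\<lambda>f x m r. m" C] by (simp add: 1 cpt_pl cpt_pr cpt_id)
  have "rec_nat a (\<lambda>m r. r - 1) b = a - b" for a b :: nat by (induction b) auto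
  moreover have "cpt (\<lambda>f z. pr (pr z) - 1)" by (intro p cpt)
  ultimately show ?thesis
    using cpt_rec[OF assms(1) _ assms(2), of "\<lambda>f x m r. r - 1"] by simp
qed

lemma dec_eq0: assumes "cpt A" shows "dec (\<lambda>f x. A f x = 0)"
proof -
  have "cpt (\<lambda>f x. 1 - A f x)" by (intro cpt assms)
  then show ?thesis unfolding dec_def by (rule cpt_cong) auto
qed

text \<open>Both branches are total, so the case distinction may evaluate both and select
  arithmetically.\<close>

lemma cpt_if [cpt]:
  assumes "dec P" "cpt A" "cpt B" shows "cpt (\<lambda>f x. if P f x then A f x else B f x)"
proof -
  have "cpt (\<lambda>f x. (if P f x then 1 else 0) * A f x + (1 - (if P f x then 1 else 0)) * B f x)"
    using assms unfolding dec_def by (intro cpt)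
  then show ?thesis by (rule cpt_cong) auto
qed

lemma dec_cong: "dec P \<Longrightarrow> (\<And>f x. P f x \<longleftrightarrow> Q f x) \<Longrightarrow> dec Q"
  unfolding dec_def by simp

lemma dec_not [cpt]: assumes "dec P" shows "dec (\<lambda>f x. \<not> P f x)"
  by (rule dec_cong[OF dec_eq0[OF assms[unfolded dec_def]]]) simp

lemma dec_conj [cpt]: assumes "dec P" "dec Q" shows "dec (\<lambda>f x. P f x \<and> Q f x)"
proof -
  have "cpt (\<lambda>f x. (if P f x then 1 else 0) * (if Q f x then 1 else 0))"
    using assms unfolding dec_def by (intro cpt_mult)
  then show ?thesis unfolding dec_def by (rule cpt_cong) auto
qed

lemma dec_disj [cpt]: assumes "dec P" "dec Q" shows "dec (\<lambda>f x. P f x \<or> Q f x)"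
  by (rule dec_cong[OF dec_not[OF dec_conj[OF dec_not[OF assms(1)] dec_not[OF assms(2)]]]]) blast

lemma dec_imp [cpt]: assumes "dec P" "dec Q" shows "dec (\<lambda>f x. P f x \<longrightarrow> Q f x)"
  by (rule dec_cong[OF dec_disj[OF dec_not[OF assms(1)] assms(2)]]) blast

lemma dec_le [cpt]: assumes "cpt A" "cpt B" shows "dec (\<lambda>f x. A f x \<le> B f x)"
  using dec_eq0[OF cpt_diff[OF assms]] by simp

lemma dec_less [cpt]: assumes "cpt A" "cpt B" shows "dec (\<lambda>f x. A f x < B f x)"
  using dec_not[OF dec_le[OF assms(2,1)]] by (simp add: not_le)

lemma dec_eq [cpt]: assumes "cpt A" "cpt B" shows "dec (\<lambda>f x. A f x = B f x)"
  using dec_conj[OF dec_le[OF assms] dec_le[OF assms(2,1)]] by (simp add: eq_iff)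

lemma dec_comp:
  assumes "dec P" "cpt A" shows "dec (\<lambda>f x. P f (A f x))"
  using cpt_comp[OF assms(1)[unfolded dec_def] assms(2)] unfolding dec_def .

lemma dec_app2:
  assumes "dec (\<lambda>f z. P f (pl z) (pr z))" "cpt A" "cpt B"
  shows "dec (\<lambda>f x. P f (A f x) (B f x))"
  using dec_comp[OF assms(1) cpt_pp[OF assms(2,3)]] by simp

lemma cpt_sum [cpt]:
  assumes "cpt (\<lambda>f z. D f (pl z) (pr z))" "cpt N"
  shows "cpt (\<lambda>f x. \<Sum>k<N f x. D f x k)"
proof -
  have 1: "rec_nat 0 (\<lambda>m r. r + g m) n = (\<Sum>k<n. g k)" for g :: "nat \<Rightarrow> nat" and n
    by (induction n) auto
  have "cpt (\<lambda>f z. pr (pr z) + D f (pl z) (pl (pr z)))"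
    by (intro cpt cpt_app2[OF assms(1)])
  then show ?thesis
    using cpt_rec[OF cpt_const[of 0] _ assms(2), of "\<lambda>f x m r. r + D f x m"] by (simp add: 1)
qed

text \<open>The counterexamples are counted by a bounded sum, which vanishes iff there are
  none.\<close>

lemma dec_all [cpt]:
  assumes "dec (\<lambda>f z. P f (pl z) (pr z))" "cpt N"
  shows "dec (\<lambda>f x. \<forall>k<N f x. P f x k)"
proof -
  have "dec (\<lambda>f x. (\<Sum>k<N f x. if \<not> P f x k then 1 else (0::nat)) = 0)"
    by (intro cpt dec_eq0 assms)
  then show ?thesis by (rule dec_cong) auto
qed

lemma dec_ex [cpt]:
  assumes "dec (\<lambda>f z. P f (pl z) (pr z))" "cpt N"
  shows "dec (\<lambda>f x. \<exists>k<N f x. P f x k)"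
  by (rule dec_cong[OF dec_not[OF dec_all[OF dec_not[OF assms(1)] assms(2)]]]) blast

lemma cpt_div [cpt]:
  assumes "cpt A" "cpt B" shows "cpt (\<lambda>f x. A f x div B f x)"
proof -
  \<comment> \<open>The quotient counts the positive multiples of \<open>b\<close> up to
    \<open>a\<close>. For \<open>b = 0\<close> this count would be \<open>a\<close>, so that case is
    set to \<open>0\<close> separately.\<close>
  have "(if b = 0 then 0 else \<Sum>j<a. if Suc j * b \<le> a then 1 else 0) = a div b" for a b :: nat
  proof (cases "b = 0")
    case False
    have "{j. j < a \<and> Suc j * b \<le> a} = {..<a div b}"
    proof (intro set_eqI iffI; clarsimp)
      fix j assume "b + j * b \<le> a"
      then have "Suc j * b \<le> a" by simp
      then have "Suc j \<le> a div b" using False by (metis div_le_mono nonzero_mult_div_cancel_right)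
      then show "j < a div b" by simp
    next
      fix j assume j: "j < a div b"
      then have "Suc j * b \<le> (a div b) * b" by (intro mult_right_mono) auto
      also have "\<dots> \<le> a" by simp
      finally have "Suc j * b \<le> a" .
      moreover have "j < a" using j div_le_dividend[of a b] by linarith
      ultimately show "j < a \<and> b + j * b \<le> a" by simp
    qed
    then have "card {j. j < a \<and> Suc j * b \<le> a} = a div b" by simp
    then show ?thesis using False by (simp add: sum.If_cases Int_def)
  qed simp
  moreover have "cpt (\<lambda>f x. if B f x = 0 then 0 else \<Sum>j<A f x. if Suc j * B f x \<le> A f x then 1 else 0)"
    by (intro cpt assms cpt_comp[OF assms(1)] cpt_comp[OF assms(2)])
  ultimately show ?thesis by simp
qed

lemma cpt_mod [cpt]:
  assumes "cpt A" "cpt B" shows "cpt (\<lambda>f x. A f x mod B f x)"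
  using cpt_diff[OF assms(1) cpt_mult[OF cpt_div[OF assms] assms(2)]]
  by (simp add: minus_div_mult_eq_mod)

section \<open>Lists\<close>

text \<open>Padding with zeros turns a finite string into a total function, so that it can be read
  computably and can also stand in as an oracle or as a point of Baire space.\<close>

definition nthd :: "nat list \<Rightarrow> nat \<Rightarrow> nat" where
  "nthd L n = (if n < length L then L ! n else 0)"

lemma list_decode_Suc: "list_decode (Suc n) = pl n # list_decode (pr n)"
  by (simp add: pl_def pr_def split: prod.split)

lemma length_list_decode_le: "length (list_decode n) \<le> n"
proof (induction n rule: less_induct)
  case (less n)
  show ?case
  proof (cases n)
    case (Suc m)
    have "pr m \<le> m" using le_pp2[of "pr m" "pl m"] by simp
    then show ?thesis using less[of "pr m"] Suc by (simp add: list_decode_Suc del: list_decode.simps)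
  qed simp
qed

lemma nth_list_less: "k < length L \<Longrightarrow> L ! k < list_encode L"
proof (induction L arbitrary: k)
  case (Cons a L)
  show ?case
    using Cons.IH[of "k - 1"] Cons.prems le_pp1[of a "list_encode L"] le_pp2[of "list_encode L" a]
    by (cases k) (auto simp: less_Suc_eq_le intro: order.trans)
qed simp

lemma mem_list_less: "x \<in> set L \<Longrightarrow> x < list_encode L"
  by (metis in_set_conv_nth nth_list_less)

text \<open>Iterated tail on list codes: a nonempty list has code \<open>Suc (pp a l)\<close>, with
  head \<open>a\<close> and tail code \<open>l\<close>, and \<open>pr 0 = 0\<close> makes the empty
  list its own tail.\<close>

definition drp :: "nat \<Rightarrow> nat \<Rightarrow> nat" where
  "drp l n = rec_nat l (\<lambda>m r. pr (r - 1)) n"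

lemma drp: "drp l n = list_encode (drop n (list_decode l))"
proof -
  have pr0: "pr 0 = 0" using le_pp2[of "pr 0" "pl 0"] by simp
  have tl: "pr (r - 1) = list_encode (tl (list_decode r))" for r
    by (cases r) (auto simp: pr0 list_decode_Suc simp del: list_decode.simps(2))
  show ?thesis
    by (induction n) (simp_all add: drp_def tl[simplified] drop_Suc tl_drop)
qed

lemma cpt_drp: "cpt A \<Longrightarrow> cpt B \<Longrightarrow> cpt (\<lambda>f x. drp (A f x) (B f x))"
  unfolding drp_def by (intro cpt cpt_rec)

lemma length_list_decode: "length (list_decode l) = (\<Sum>k<l. if drp l k \<noteq> 0 then 1 else 0)"
proof -
  have nz: "0 < list_encode L \<longleftrightarrow> L \<noteq> []" for L by (cases L) auto
  have "{..<l} \<inter> {k. k < length (list_decode l)} = {..<length (list_decode l)}"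
    using length_list_decode_le[of l] by auto
  then show ?thesis by (simp add: drp nz sum.If_cases not_le)
qed

lemma nthd_list_decode: "nthd (list_decode l) n = (if drp l n = 0 then 0 else pl (drp l n - 1))"
proof (cases "n < length (list_decode l)")
  case True
  have "drp l n = list_encode (list_decode l ! n # drop (Suc n) (list_decode l))"
    unfolding drp by (subst Cons_nth_drop_Suc[OF True]) (rule refl)
  with True show ?thesis by (simp add: nthd_def)
next
  case False
  then show ?thesis by (simp add: nthd_def drp)
qed

lemma cpt_length [cpt]:
  assumes "cptl L" shows "cpt (\<lambda>f x. length (L f x))"
proof -
  have "cpt (\<lambda>f x. \<Sum>k<x. if drp x k \<noteq> 0 then 1 else 0)"
    by (intro cpt cpt_drp)
  from cpt_comp[OF this assms[unfolded cptl_def]] show ?thesis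
    by (simp only: length_list_decode[symmetric] list_encode_inverse)
qed

lemma cpt_nthd [cpt]:
  assumes "cptl L" "cpt N" shows "cpt (\<lambda>f x. nthd (L f x) (N f x))"
proof -
  have "cpt (\<lambda>f z. nthd (list_decode (pl z)) (pr z))"
    unfolding nthd_list_decode by (intro cpt cpt_drp)
  from cpt_app2[OF this assms(1)[unfolded cptl_def] assms(2)] show ?thesis
    by (simp only: list_encode_inverse)
qed

lemma cptl_decode [cpt]: "cpt A \<Longrightarrow> cptl (\<lambda>f x. list_decode (A f x))"
  by (simp add: cptl_def)

lemma cpt_encode [cpt]: "cptl L \<Longrightarrow> cpt (\<lambda>f x. list_encode (L f x))"
  by (simp add: cptl_def)

lemma cptl_comp: "cptl L \<Longrightarrow> cpt A \<Longrightarrow> cptl (\<lambda>f x. L f (A f x))"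
  unfolding cptl_def by (rule cpt_comp)

lemma cptl_tab [cpt]:
  assumes "cpt (\<lambda>f z. D f (pl z) (pr z))" "cpt N"
  shows "cptl (\<lambda>f x. map (D f x) [0..<N f x])"
proof -
  \<comment> \<open>Consing is the cheap operation on codes, so the table is filled from its end:
    after \<open>k\<close> rounds it holds the last \<open>k\<close> entries.\<close>
  have eq: "rec_nat 0 (\<lambda>m r. Suc (pp (g (n - Suc m)) r)) k = list_encode (map g [n - k..<n])"
    if "k \<le> n" for g n k
    using that
  proof (induction k)
    case (Suc k)
    then have "[n - Suc k..<n] = (n - Suc k) # [n - k..<n]"
      by (metis Suc_diff_Suc diff_less less_le_trans upt_conv_Cons zero_less_Suc Suc_le_lessD diff_le_self)
    with Suc show ?case by simp
  qed simp
  have "cpt (\<lambda>f z. Suc (pp (D f (pl z) (N f (pl z) - Suc (pl (pr z)))) (pr (pr z))))"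
    by (intro cpt cpt_app2[OF assms(1)] cpt_comp[OF assms(2)])
  from cpt_rec[OF cpt_const[of 0] this assms(2)] show ?thesis
    unfolding cptl_def by (simp add: eq)
qed

lemma cptl_cong: "cptl F \<Longrightarrow> (\<And>f x. F f x = G f x) \<Longrightarrow> cptl G"
  unfolding cptl_def by simp

lemma dec_list_eq [cpt]:
  assumes "cptl A" "cptl B" shows "dec (\<lambda>f x. A f x = B f x)"
  using dec_eq[OF assms[unfolded cptl_def]] by (simp add: list_encode_eq)

lemma cptl_append [cpt]:
  assumes "cptl A" "cptl B" shows "cptl (\<lambda>f x. A f x @ B f x)"
proof -
  have "cptl (\<lambda>f x. map (\<lambda>k. if k < length (A f x) then nthd (A f x) k
      else nthd (B f x) (k - length (A f x))) [0..<length (A f x) + length (B f x)])"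
    by (intro cpt assms cptl_comp[OF assms(1)] cptl_comp[OF assms(2)])
  then show ?thesis
    by (rule cptl_cong, intro nth_equalityI) (auto simp: nth_append nthd_def)
qed

lemma cptl_take [cpt]:
  assumes "cptl A" "cpt N" shows "cptl (\<lambda>f x. take (N f x) (A f x))"
proof -
  have "cptl (\<lambda>f x. map (nthd (A f x)) [0..<if N f x < length (A f x) then N f x else length (A f x)])"
    by (intro cpt assms cptl_comp[OF assms(1)])
  then show ?thesis
    by (rule cptl_cong, intro nth_equalityI) (auto simp: nthd_def split: if_splits)
qed

lemma cptl_single [cpt]: "cpt A \<Longrightarrow> cptl (\<lambda>f x. [A f x])"
  unfolding cptl_def by (simp, intro cpt)

lemma dec_prefix [cpt]:
  assumes "cptl A" "cptl B" shows "dec (\<lambda>f x. prefix (A f x) (B f x))"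
proof -
  have "dec (\<lambda>f x. take (length (A f x)) (B f x) = A f x)" by (intro cpt assms)
  then show ?thesis by (rule dec_cong) (metis append_eq_conv_conj prefix_def)
qed

lemma dec_binary [cpt]:
  assumes "cptl A" shows "dec (\<lambda>f x. A f x \<in> binary_strings)"
proof -
  have "dec (\<lambda>f x. \<forall>k<length (A f x). nthd (A f x) k \<le> 1)" by (intro cpt assms cptl_comp[OF assms])
  then show ?thesis
    by (rule dec_cong) (fastforce simp: binary_strings_def nthd_def set_conv_nth le_Suc_eq)
qed

lemma dec_mem [cpt]:
  assumes "cptl A" "cpt B" shows "dec (\<lambda>f x. B f x \<in> set (A f x))"
proof -
  have "dec (\<lambda>f x. \<exists>k<length (A f x). nthd (A f x) k = B f x)"
    by (intro cpt assms cptl_comp[OF assms(1)] cpt_comp[OF assms(2)])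
  then show ?thesis
    by (rule dec_cong) (auto simp: nthd_def in_set_conv_nth)
qed

lemma cptl_restr [cpt]: "cpt N \<Longrightarrow> cptl (\<lambda>f x. restr f (N f x))"
  unfolding restr_def by (intro cpt cpt_oracle)

section \<open>Unbounded search, c.e. sets and the s-m-n theorem\<close>

text \<open>The search predicate is decided by a total code, so the definedness clause of
  \<open>Mu\<close> always holds. \<open>H\<close> then works on the input paired with the least
  witness.\<close>

lemma mu_search:
  assumes "dec (\<lambda>f z. P f (pl z) (pr z))" "cpt (\<lambda>f z. H f (pl z) (pr z))"
  shows "\<exists>c. \<forall>f x. Phi c f x = (if \<exists>n. P f x n then Some (H f x (LEAST n. P f x n)) else None)"
proof -
  obtain c where c: "\<And>f z. eval c f z = Some (if \<not> P f (pl z) (pr z) then 1 else 0)"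
    using dec_not[OF assms(1)] unfolding dec_def cpt_def by blast
  obtain h where h: "\<And>f z. eval h f z = Some (H f (pl z) (pr z))"
    using assms(2) unfolding cpt_def by blast
  let ?k = "Comp h (Pairing (Pairing Left Right) (Mu c))"
  obtain k where "code_of k = ?k" using surj_code_of by (metis surjD)
  then have "Phi k f x = eval ?k f x" for f x by (simp add: Phi_def)
  then have "\<forall>f x. Phi k f x = (if \<exists>n. P f x n then Some (H f x (LEAST n. P f x n)) else None)"
    by (auto simp: c h cong: conj_cong)
  then show ?thesis by blast
qed

text \<open>The index is independent of the oracle, so it may be read relative to
  \<open>no_oracle\<close> as well as to \<open>halting_oracle\<close>.\<close>

lemma dec_ce:
  assumes "dec (\<lambda>f z. P f (pl z) (pr z))"
  obtains c where "\<And>f x. x \<in> W_rel f c \<longleftrightarrow> (\<exists>n. P f x n)"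
proof -
  obtain c where c: "\<forall>f x. Phi c f x = (if \<exists>n. P f x n then Some 0 else None)"
    using mu_search[of P "\<lambda>_ _ _. 0", OF assms cpt_const] by blast
  show thesis by (rule that[of c]) (simp add: c W_rel_def)
qed

lemma computableI: "cpt (\<lambda>f. h) \<Longrightarrow> computable h"
  unfolding cpt_def computable_def Phi_def by (metis surj_code_of surjD)

text \<open>Inverts \<open>code_of\<close>: after the five basic codes, residue 0 modulo 4 stands
  for \<open>Pairing\<close> and residue 1 for \<open>Comp\<close>.\<close>

definition pair_index :: "nat \<Rightarrow> nat \<Rightarrow> nat" where
  "pair_index a b = Suc (Suc (Suc (Suc (Suc (4 * pp a b)))))"

definition comp_index :: "nat \<Rightarrow> nat \<Rightarrow> nat" where
  "comp_index a b = Suc (Suc (Suc (Suc (Suc (4 * pp a b + 1)))))"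

lemma code_of_pair_index: "code_of (pair_index a b) = Pairing (code_of a) (code_of b)"
  unfolding pair_index_def by (simp add: Let_def)

lemma code_of_comp_index: "code_of (comp_index a b) = Comp (code_of a) (code_of b)"
proof -
  have "(4 * pp a b + 1) div 4 = pp a b" "(4 * pp a b + 1) mod 4 = 1" by presburger+
  then show ?thesis unfolding comp_index_def by (simp only: code_of.simps Let_def) simp
qed

text \<open>Index \<open>0\<close> is \<open>Zero\<close> and index \<open>1\<close> is
  \<open>Succ\<close>, so this composes \<open>n\<close> successors with zero.\<close>

definition const_index :: "nat \<Rightarrow> nat" where
  "const_index n = rec_nat 0 (\<lambda>m r. comp_index 1 r) n"

lemma Phi_const_index: "Phi (const_index n) f x = Some n"
  by (induction n) (simp_all add: Phi_def const_index_def code_of_comp_index)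

text \<open>Precomposes with pairing by \<open>n\<close>. Indices \<open>2\<close> and
  \<open>3\<close> are the two projections, so pairing them gives an index of the identity.\<close>

definition smn :: "nat \<Rightarrow> nat \<Rightarrow> nat" where
  "smn c n = comp_index c (pair_index (const_index n) (pair_index 2 3))"

lemma Phi_smn: "Phi (smn c n) f x = Phi c f (pp n x)"
proof -
  have "code_of 2 = Left" "code_of 3 = Right"
    by (simp_all add: numeral_2_eq_2 numeral_3_eq_3)
  then show ?thesis
    using Phi_const_index[of n f x]
    by (simp add: Phi_def smn_def code_of_comp_index code_of_pair_index)
qed

lemma W_smn: "x \<in> W_rel f (smn c n) \<longleftrightarrow> pp n x \<in> W_rel f c"
  by (simp add: W_rel_def Phi_smn)

lemma cpt_smn [cpt]:
  assumes "cpt A" shows "cpt (\<lambda>f x. smn c (A f x))"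
proof -
  have "cpt (\<lambda>f x. const_index x)"
    unfolding const_index_def comp_index_def by (intro cpt cpt_rec)
  from cpt_comp[OF this assms] show ?thesis
    unfolding smn_def comp_index_def pair_index_def by (intro cpt)
qed

section \<open>Computations as finite certificates\<close>

lemma cptl_drop [cpt]:
  assumes "cptl A" "cpt N" shows "cptl (\<lambda>f x. drop (N f x) (A f x))"
  using cpt_drp[OF assms(1)[unfolded cptl_def] assms(2)] by (simp add: drp cptl_def)

definition trip :: "nat \<Rightarrow> nat \<Rightarrow> nat \<Rightarrow> nat" where
  "trip e x y = pp e (pp x y)"

lemma trip_inject [simp]: "trip e x y = trip e' x' y' \<longleftrightarrow> e = e' \<and> x = x' \<and> y = y'"
  by (simp add: trip_def prod_encode_eq)

text \<open>A derivation of \<open>\<Phi>\<^sub>e(x) = y\<close> from earlier ones, following the clauses of \<^const>\<open>code_of\<close> and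
  \<^const>\<open>eval\<close>; the oracle is known only up to the length of \<open>\<sigma>\<close>.\<close>

definition justified :: "nat list \<Rightarrow> nat set \<Rightarrow> nat \<Rightarrow> nat \<Rightarrow> nat \<Rightarrow> bool" where
  "justified \<sigma> M e x y \<longleftrightarrow>
    (if e = 0 then y = 0 else if e = 1 then y = Suc x else if e = 2 then y = pl x
     else if e = 3 then y = pr x else if e = 4 then x < length \<sigma> \<and> y = nthd \<sigma> x
     else if (e - 5) mod 4 = 0 then
       trip (pl ((e - 5) div 4)) x (pl y) \<in> M \<and> trip (pr ((e - 5) div 4)) x (pr y) \<in> M
     else if (e - 5) mod 4 = 1 then
       \<exists>u. trip (pr ((e - 5) div 4)) x u \<in> M \<and> trip (pl ((e - 5) div 4)) u y \<in> M
     else if (e - 5) mod 4 = 2 then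
       (if pr x = 0 then trip (pl ((e - 5) div 4)) (pl x) y \<in> M
        else \<exists>u. trip e (pp (pl x) (pr x - 1)) u \<in> M \<and>
               trip (pr ((e - 5) div 4)) (pp (pl x) (pp (pr x - 1) u)) y \<in> M)
     else trip ((e - 5) div 4) (pp x y) 0 \<in> M \<and>
       (\<forall>z<y. \<exists>u. trip ((e - 5) div 4) (pp x z) (Suc u) \<in> M))"

text \<open>The latest derivation stands first: each triple rests only on triples further down the
  list, which excludes circular derivations.\<close>

fun valid :: "nat list \<Rightarrow> nat list \<Rightarrow> bool" where
  "valid \<sigma> [] \<longleftrightarrow> True"
| "valid \<sigma> (t # L) \<longleftrightarrow> valid \<sigma> L \<and> justified \<sigma> (set L) (pl t) (pl (pr t)) (pr (pr t))"

definition certifies :: "nat list \<Rightarrow> nat \<Rightarrow> nat \<Rightarrow> nat \<Rightarrow> nat \<Rightarrow> bool" where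
  "certifies \<sigma> e x y l \<longleftrightarrow> valid \<sigma> (list_decode l) \<and> trip e x y \<in> set (list_decode l)"

lemma justified_mono:
  assumes "justified \<sigma> M e x y" "M \<subseteq> M'" "prefix \<sigma> \<sigma>'"
  shows "justified \<sigma>' M' e x y"
proof -
  have "x < length \<sigma>' \<and> nthd \<sigma>' x = nthd \<sigma> x" if "x < length \<sigma>"
    using assms(3) that by (auto simp: prefix_def nthd_def nth_append)
  moreover have "trip a b c \<in> M'" if "trip a b c \<in> M" for a b c using that assms(2) by blast
  ultimately show ?thesis using assms(1) unfolding justified_def by (smt (verit))
qed

lemma valid_mono: "valid \<sigma> L \<Longrightarrow> prefix \<sigma> \<sigma>' \<Longrightarrow> valid \<sigma>' L"
  by (induction L) (auto intro: justified_mono)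

lemma valid_append: "valid \<sigma> L \<Longrightarrow> valid \<sigma> L' \<Longrightarrow> valid \<sigma> (L @ L')"
  by (induction L) (auto intro: justified_mono)

lemma certifies_mono: "certifies \<sigma> e x y l \<Longrightarrow> prefix \<sigma> \<sigma>' \<Longrightarrow> certifies \<sigma>' e x y l"
  unfolding certifies_def by (auto intro: valid_mono)

lemma length_restr [simp]: "length (restr f k) = k"
  by (simp add: restr_def)

lemma nthd_restr: "x < k \<Longrightarrow> nthd (restr f k) x = f x"
  by (simp add: restr_def nthd_def)

lemma prefix_restr: "k \<le> m \<Longrightarrow> prefix (restr f k) (restr f m)"
  by (metis append_take_drop_id prefixI restr_def take_map take_upt add_0)

lemma code_of_cases:
  fixes e :: nat
  obtains "e = 0" "code_of e = Zero" | "e = 1" "code_of e = Succ" | "e = 2" "code_of e = Left"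
  | "e = 3" "code_of e = Right" | "e = 4" "code_of e = Oracle"
  | n where "e = n + 5" "n mod 4 = 0"
      "code_of e = Pairing (code_of (pl (n div 4))) (code_of (pr (n div 4)))"
  | n where "e = n + 5" "n mod 4 = 1"
      "code_of e = Comp (code_of (pl (n div 4))) (code_of (pr (n div 4)))"
  | n where "e = n + 5" "n mod 4 = 2"
      "code_of e = Prec (code_of (pl (n div 4))) (code_of (pr (n div 4)))"
  | n where "e = n + 5" "n mod 4 = 3" "code_of e = Mu (code_of (n div 4))"
proof -
  consider "e = 0" | "e = 1" | "e = 2" | "e = 3" | "e = 4" | n where "e = n + 5"
    using that by (metis One_nat_def add.commute le_Suc_ex not_less_eq_eq numeral_nat(2-5) zero_less_Suc
        eval_nat_numeral le_0_eq le_SucE)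
  then show thesis
  proof cases
    case (6 n)
    have e: "e = Suc (Suc (Suc (Suc (Suc n))))" using 6 by simp
    have "n mod 4 < 4" by simp
    then consider "n mod 4 = 0" | "n mod 4 = 1" | "n mod 4 = 2" | "n mod 4 = 3" by linarith
    then show thesis
    proof cases
      case 1 then show thesis using that(6)[of n] 6 by (simp add: e Let_def pl_def pr_def)
    next
      case 2 then show thesis using that(7)[of n] 6 by (simp add: e Let_def pl_def pr_def)
    next
      case 3 then show thesis using that(8)[of n] 6 by (simp add: e Let_def pl_def pr_def)
    next
      case 4 then show thesis using that(9)[of n] 6 by (simp add: e Let_def pl_def pr_def)
    qed
  qed (use that(1-5) in \<open>simp_all add: eval_nat_numeral\<close>)
qed

lemma justified_sound:
  assumes j: "justified (restr f k) M e x y"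
    and M: "\<And>e x y. trip e x y \<in> M \<Longrightarrow> Phi e f x = Some y"
  shows "Phi e f x = Some y"
proof -
  note M' = M[unfolded Phi_def]
  show ?thesis
  proof (cases rule: code_of_cases[of e])
    case 5
    then show ?thesis using j by (simp add: justified_def Phi_def nthd_restr)
  next
    case (6 n)
    then show ?thesis using j by (auto simp: justified_def Phi_def dest!: M')
  next
    case (7 n)
    then show ?thesis using j by (auto simp: justified_def Phi_def dest!: M')
  next
    case (8 n)
    show ?thesis
    proof (cases "pr x")
      case 0
      have "eval (code_of (pl (n div 4))) f (pl x) = Some y"
        using 8 0 j by (intro M') (auto simp: justified_def)
      then show ?thesis
        by (simp only: Phi_def 8(3) eval.simps Let_def pl_def[symmetric] pr_def[symmetric] 0 old.nat.rec)
    next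
      case (Suc k)
      with 8 j obtain u where "trip e (pp (pl x) k) u \<in> M"
        "trip (pr (n div 4)) (pp (pl x) (pp k u)) y \<in> M"
        by (auto simp: justified_def)
      note u = M[OF this(1)] M'[OF this(2)]
      have "eval (Prec (code_of (pl (n div 4))) (code_of (pr (n div 4)))) f (pp (pl x) k) = Some u"
        using u(1) by (simp only: Phi_def 8(3))
      with u(2) show ?thesis
        by (simp only: Phi_def 8(3) eval.simps Let_def pl_def[symmetric] pr_def[symmetric] Suc
            old.nat.rec pl_pp pr_pp bind.simps)
    qed
  next
    case (9 n)
    with j have t: "trip (n div 4) (pp x y) 0 \<in> M"
      "\<And>z. z < y \<Longrightarrow> \<exists>u. trip (n div 4) (pp x z) (Suc u) \<in> M"
      by (simp_all add: justified_def)
    have y: "eval (code_of (n div 4)) f (pp x y) = Some 0" using t(1) by (rule M')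
    have z: "\<exists>u. eval (code_of (n div 4)) f (pp x z) = Some (Suc u)" if "z < y" for z
      using t(2)[OF that] M' by blast
    have "(LEAST n'. eval (code_of (n div 4)) f (pp x n') = Some 0) = y"
      using y z by (intro Least_equality) (auto simp: not_less[symmetric], force)
    then show ?thesis using y z 9 by (fastforce simp: Phi_def)
  qed (use j in \<open>simp_all add: justified_def Phi_def pl_def pr_def\<close>)
qed

lemma valid_sound:
  "valid (restr f k) L \<Longrightarrow> trip e x y \<in> set L \<Longrightarrow> Phi e f x = Some y"
proof (induction L arbitrary: e x y)
  case (Cons t L)
  show ?case
  proof (cases "t = trip e x y")
    case True
    then show ?thesis using Cons justified_sound[of f k "set L" e x y] by (simp add: trip_def)
  qed (use Cons in auto)
qed simp

section \<open>Completeness of finite certificates\<close>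

definition derivable :: "(nat \<Rightarrow> nat) \<Rightarrow> nat set" where
  "derivable f = {t. \<exists>k L. valid (restr f k) L \<and> t \<in> set L}"

lemma derivable_collect:
  assumes "finite S" "S \<subseteq> derivable f"
  shows "\<exists>k\<ge>k0. \<exists>L. valid (restr f k) L \<and> S \<subseteq> set L"
  using assms
proof (induction S)
  case empty
  then show ?case by (intro exI[of _ k0] conjI exI[of _ "[]"]) auto
next
  case (insert t S)
  then obtain k L k' L' where "k \<ge> k0" "valid (restr f k) L" "S \<subseteq> set L"
    "valid (restr f k') L'" "t \<in> set L'" unfolding derivable_def by auto
  then have "valid (restr f (max k k')) (L' @ L)"
    by (intro valid_append) (metis valid_mono prefix_restr max.cobounded1 max.cobounded2)+
  then show ?case using \<open>k \<ge> k0\<close> \<open>S \<subseteq> set L\<close> \<open>t \<in> set L'\<close>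
    by (intro exI[of _ "max k k'"] conjI exI[of _ "L' @ L"]) auto
qed

text \<open>Finitely many premises have a common certificate over a common finite part of the
  oracle, and one more triple can be put in front of it.\<close>

lemma derivable_step:
  assumes "finite S" "S \<subseteq> derivable f" "justified (restr f k0) S e x y"
  shows "trip e x y \<in> derivable f"
proof -
  obtain k L where k: "k \<ge> k0" "valid (restr f k) L" "S \<subseteq> set L"
    using derivable_collect[OF assms(1,2)] by blast
  have "justified (restr f k) (set L) e x y"
    using assms(3) k(3) prefix_restr[OF k(1)] by (rule justified_mono)
  then have "valid (restr f k) (trip e x y # L)" using k by (simp add: trip_def)
  then show ?thesis unfolding derivable_def by (metis (mono_tags, lifting) list.set_intros(1) mem_Collect_eq)
qed

lemma pl_le: "pl n \<le> n" and pr_le: "pr n \<le> n"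
  using le_pp1[of "pl n" "pr n"] le_pp2[of "pr n" "pl n"] by simp_all

text \<open>Immediate subcodes have smaller indices, so induction on \<open>e\<close> applies.
  Primitive recursion refers back to \<open>e\<close> itself and needs an inner induction on the
  recursion argument.\<close>

lemma derivable_complete: "Phi e f x = Some y \<Longrightarrow> trip e x y \<in> derivable f"
proof (induction e arbitrary: x y rule: less_induct)
  case (less e)
  have small: "pl (n div 4) < e" "pr (n div 4) < e" "n div 4 < e" if "e = n + 5" for n
    using pl_le[of "n div 4"] pr_le[of "n div 4"] that by linarith+
  note IH = less.IH[unfolded Phi_def, OF small(1)] less.IH[unfolded Phi_def, OF small(2)]
    less.IH[unfolded Phi_def, OF small(3)]
  note P = less.prems
  show ?case
  proof (cases rule: code_of_cases[of e])
    case 5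
    then show ?thesis using P
      by (intro derivable_step[of "{}" f "Suc x"]) (simp_all add: justified_def Phi_def nthd_restr)
  next
    case (6 n)
    then show ?thesis using P IH[OF 6(1)]
      by (intro derivable_step[of "{trip (pl (n div 4)) x (pl y), trip (pr (n div 4)) x (pr y)}" f 0])
        (auto simp: justified_def Phi_def bind_eq_Some_conv)
  next
    case (7 n)
    then obtain u where "eval (code_of (pr (n div 4))) f x = Some u"
      "eval (code_of (pl (n div 4))) f u = Some y"
      using P by (auto simp: Phi_def bind_eq_Some_conv)
    then show ?thesis using 7 IH[OF 7(1)]
      by (intro derivable_step[of "{trip (pl (n div 4)) u y, trip (pr (n div 4)) x u}" f 0])
        (auto simp: justified_def)
  next
    case (8 n)
    have "Phi e f (pp a m) = Some v \<Longrightarrow> trip e (pp a m) v \<in> derivable f" for a m v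
    proof (induction m arbitrary: v)
      case 0
      then show ?case using 8 IH[OF 8(1)]
        by (intro derivable_step[of "{trip (pl (n div 4)) a v}" f 0]) (auto simp: justified_def Phi_def)
    next
      case (Suc m)
      then obtain u where u: "Phi e f (pp a m) = Some u"
        "eval (code_of (pr (n div 4))) f (pp a (pp m u)) = Some v"
        using 8 by (auto simp: Phi_def bind_eq_Some_conv)
      then show ?case using 8 IH[OF 8(1)] Suc.IH[OF u(1)]
        by (intro derivable_step[of "{trip (pr (n div 4)) (pp a (pp m u)) v, trip e (pp a m) u}" f 0])
          (auto simp: justified_def)
    qed
    from this[of "pl x" "pr x" y] P show ?thesis by simp
  next
    case (9 n)
    let ?c = "code_of (n div 4)"
    from P 9 obtain n' where n': "eval ?c f (pp x n') = Some 0" "\<And>m. m < n' \<Longrightarrow> eval ?c f (pp x m) \<noteq> None"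
      and y: "y = (LEAST n. eval ?c f (pp x n) = Some 0)"
      by (auto simp: Phi_def split: if_splits)
    have y0: "eval ?c f (pp x y) = Some 0" unfolding y using n'(1) by (rule LeastI)
    have "y \<le> n'" unfolding y using n'(1) by (rule Least_le)
    have "\<exists>u. eval ?c f (pp x m) = Some (Suc u)" if "m < y" for m
    proof -
      have "eval ?c f (pp x m) \<noteq> Some 0" using not_less_Least that unfolding y by blast
      moreover have "eval ?c f (pp x m) \<noteq> None" using n'(2)[of m] that \<open>y \<le> n'\<close> by simp
      ultimately show ?thesis by (metis not0_implies_Suc option.exhaust)
    qed
    then obtain u where u: "\<And>m. m < y \<Longrightarrow> eval ?c f (pp x m) = Some (Suc (u m))" by metis
    show ?thesis using y0 u 9 IH[OF 9(1)]
      by (intro derivable_step[of "insert (trip (n div 4) (pp x y) 0) ((\<lambda>m. trip (n div 4) (pp x m) (Suc (u m))) ` {..<y})" f 0])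
        (auto simp: justified_def)
  qed (use P in \<open>auto simp: justified_def Phi_def pl_def pr_def intro!: derivable_step[of "{}" f 0]\<close>)
qed

lemma certifies_sound: "certifies (restr f k) e x y l \<Longrightarrow> Phi e f x = Some y"
  unfolding certifies_def by (auto intro: valid_sound)

lemma certifies_complete:
  assumes "Phi e f x = Some y" shows "\<exists>k l. certifies (restr f k) e x y l"
proof -
  obtain k L where "valid (restr f k) L" "trip e x y \<in> set L"
    using derivable_complete[OF assms] unfolding derivable_def by blast
  then have "certifies (restr f k) e x y (list_encode L)" by (simp add: certifies_def)
  then show ?thesis by blast
qed

text \<open>Members of a list lie below its code. This bounds the quantifiers over intermediate
  values in \<open>justified\<close> and so makes it decidable.\<close>

lemma ex_bounded_trip:
  "(\<exists>u. trip a x u \<in> set L \<and> Q u) \<longleftrightarrow> (\<exists>u<list_encode L. trip a x u \<in> set L \<and> Q u)"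
proof -
  have "u < list_encode L" if "trip a x u \<in> set L" for u
    using mem_list_less[OF that] le_pp2[of "pp x u" a] le_pp2[of u x] by (simp add: trip_def)
  then show ?thesis by blast
qed

lemma ex_bounded_trip_Suc:
  "(\<exists>u. trip a x (Suc u) \<in> set L) \<longleftrightarrow> (\<exists>u<list_encode L. trip a x (Suc u) \<in> set L)"
proof -
  have "u < list_encode L" if "trip a x (Suc u) \<in> set L" for u
    using mem_list_less[OF that] le_pp2[of "pp x (Suc u)" a] le_pp2[of "Suc u" x] by (simp add: trip_def)
  then show ?thesis by blast
qed

lemma valid_iff:
  "valid \<sigma> L \<longleftrightarrow> (\<forall>k<length L. justified \<sigma> (set (drop (Suc k) L))
     (pl (nthd L k)) (pl (pr (nthd L k))) (pr (pr (nthd L k))))"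
proof (induction L)
  case (Cons t L)
  have "(\<forall>k<Suc n. Q k) \<longleftrightarrow> Q 0 \<and> (\<forall>k<n. Q (Suc k))" for n and Q :: "nat \<Rightarrow> bool"
    by (metis less_Suc_eq_0_disj)
  moreover have "nthd (t # L) (Suc k) = nthd L k" "nthd (t # L) 0 = t" for k
    by (simp_all add: nthd_def)
  ultimately show ?case using Cons by auto
qed simp

lemma cpt_trip [cpt]: "cpt A \<Longrightarrow> cpt B \<Longrightarrow> cpt C \<Longrightarrow> cpt (\<lambda>f x. trip (A f x) (B f x) (C f x))"
  unfolding trip_def by (intro cpt)

lemma dec_if [cpt]:
  assumes "dec P" "dec Q" "dec R" shows "dec (\<lambda>f x. if P f x then Q f x else R f x)"
proof -
  have "dec (\<lambda>f x. (P f x \<and> Q f x) \<or> (\<not> P f x \<and> R f x))" by (intro cpt assms)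
  then show ?thesis by (rule dec_cong) auto
qed

lemma dec_justified:
  assumes "cptl S" "cptl L" "cpt E" "cpt X" "cpt Y"
  shows "dec (\<lambda>f x. justified (S f x) (set (L f x)) (E f x) (X f x) (Y f x))"
proof -
  \<comment> \<open>With the arguments packed into one number, every occurrence is a projection of
    the input and \<open>intro cpt\<close> can work syntactically.\<close>
  define S' L' E' X' Y' where d: "S' = (\<lambda>z. list_decode (pl z))" "L' = (\<lambda>z. list_decode (pl (pr z)))"
    "E' = (\<lambda>z. pl (pr (pr z)))" "X' = (\<lambda>z. pl (pr (pr (pr z))))" "Y' = (\<lambda>z. pr (pr (pr (pr z))))"
  have "dec (\<lambda>f z. justified (S' z) (set (L' z)) (E' z) (X' z) (Y' z))"
    unfolding justified_def ex_bounded_trip ex_bounded_trip_Suc d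
    by (intro cpt)
  from dec_comp[OF this, of "\<lambda>f x. pp (list_encode (S f x)) (pp (list_encode (L f x)) (pp (E f x) (pp (X f x) (Y f x))))"]
  show ?thesis using assms by (simp add: d cpt_pp cpt_encode)
qed

lemma dec_certifies [cpt]:
  assumes "cptl S" "cpt E" "cpt X" "cpt Y" "cpt L"
  shows "dec (\<lambda>f x. certifies (S f x) (E f x) (X f x) (Y f x) (L f x))"
proof -
  have "dec (\<lambda>f z. valid (list_decode (pl z)) (list_decode (pr z)))"
    unfolding valid_iff by (intro cpt dec_justified)
  from dec_app2[of "\<lambda>f a b. valid (list_decode a) (list_decode b)", OF this
      assms(1)[unfolded cptl_def] assms(5)]
  have "dec (\<lambda>f x. valid (S f x) (list_decode (L f x)))" by simp
  then show ?thesis unfolding certifies_def by (intro cpt assms)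
qed

text \<open>\<open>w\<close> codes an oracle length and a certificate rather than a running time.
  Bounding the value by \<open>w\<close> loses nothing, because a value lies below its
  certificate.\<close>

definition halts_by :: "nat \<Rightarrow> nat \<Rightarrow> nat \<Rightarrow> bool" where
  "halts_by e x w \<longleftrightarrow> (\<exists>y<w. certifies (restr no_oracle (pl w)) e x y (pr w))"

lemma certifies_less: "certifies \<sigma> e x y l \<Longrightarrow> y < l"
  unfolding certifies_def
  using mem_list_less[of "trip e x y" "list_decode l"] le_pp2[of "pp x y" e] le_pp2[of y x]
  by (auto simp: trip_def)

lemma W_iff_halts_by: "x \<in> W_rel no_oracle e \<longleftrightarrow> (\<exists>w. halts_by e x w)"
proof
  assume "x \<in> W_rel no_oracle e"
  then obtain y where "Phi e no_oracle x = Some y" unfolding W_rel_def by blast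
  then obtain k l where kl: "certifies (restr no_oracle k) e x y l" using certifies_complete by blast
  then have "y < pp k l" using certifies_less[OF kl] le_pp2[of l k] by simp
  then have "halts_by e x (pp k l)" unfolding halts_by_def using kl by auto
  then show "\<exists>w. halts_by e x w" by blast
next
  assume "\<exists>w. halts_by e x w"
  then show "x \<in> W_rel no_oracle e"
    unfolding halts_by_def W_rel_def using certifies_sound by blast
qed

lemma dec_halts_by [cpt]:
  assumes "cpt E" "cpt X" "cpt W"
  shows "dec (\<lambda>f x. halts_by (E f x) (X f x) (W f x))"
proof -
  have "dec (\<lambda>f z. halts_by (pl z) (pl (pr z)) (pr (pr z)))"
    unfolding halts_by_def restr_def no_oracle_def by (intro cpt)
  from dec_comp[OF this cpt_pp[OF assms(1) cpt_pp[OF assms(2,3)]]] show ?thesis by simp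
qed

section \<open>The coin measure of clopen sets\<close>

interpretation coin: prob_space coin_measure
  unfolding coin_measure_def by (intro prob_space_PiM prob_space_measure_pmf)

lemma in_cylinder_iff: "X \<in> cylinder \<sigma> \<longleftrightarrow> restr X (length \<sigma>) = \<sigma>"
  by (simp add: cylinder_def)

lemma restr_binary: "X \<in> cantor \<Longrightarrow> restr X n \<in> binary_strings"
  by (auto simp: cantor_def binary_strings_def restr_def image_subset_iff)

lemma measure_cylinder:
  assumes "\<sigma> \<in> binary_strings"
  shows "measure coin_measure (cylinder \<sigma>) = (1 / 2) ^ length \<sigma>"
proof -
  let ?M = "\<lambda>_::nat. measure_pmf (pmf_of_set {0, 1::nat})"
  have "cylinder \<sigma> = prod_emb UNIV ?M {..<length \<sigma>} (PiE {..<length \<sigma>} (\<lambda>i. {\<sigma> ! i}))"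
  proof -
    have "cylinder \<sigma> = {X. \<forall>i<length \<sigma>. X i = \<sigma> ! i}"
      unfolding cylinder_def restr_def list_eq_iff_nth_eq by simp
    also have "\<dots> = prod_emb UNIV ?M {..<length \<sigma>} (PiE {..<length \<sigma>} (\<lambda>i. {\<sigma> ! i}))"
      unfolding prod_emb_def set_eq_iff by (simp add: Pi_iff Ball_def)
    finally show ?thesis .
  qed
  then have "emeasure coin_measure (cylinder \<sigma>) = (\<Prod>i<length \<sigma>. emeasure (?M i) {\<sigma> ! i})"
    unfolding coin_measure_def
    by (simp only:) (intro emeasure_PiM_emb prob_space_measure_pmf; simp)
  also have "\<dots> = (\<Prod>i<length \<sigma>. ennreal (1 / 2))"
  proof (rule prod.cong)
    fix i assume "i \<in> {..<length \<sigma>}"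
    then have "\<sigma> ! i \<in> {0, 1}" using assms unfolding binary_strings_def by (auto dest: nth_mem)
    then show "emeasure (?M i) {\<sigma> ! i} = ennreal (1 / 2)"
      by (auto simp: emeasure_pmf_single pmf_of_set)
  qed simp
  also have "\<dots> = ennreal ((1 / 2) ^ length \<sigma>)"
    unfolding prod_constant card_lessThan by (rule ennreal_power) simp
  finally show ?thesis by (simp add: measure_def)
qed

lemma AE_cantor: "AE X in coin_measure. X \<in> cantor"
proof -
  have "AE X in coin_measure. X i \<in> {0, 1}" for i
  proof -
    have "AE x in measure_pmf (pmf_of_set {0, 1::nat}). x \<in> {0, 1}"
      by (simp add: AE_measure_pmf_iff)
    then show ?thesis unfolding coin_measure_def
      by (rule AE_PiM_component[rotated 2]) (auto intro: prob_space_measure_pmf)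
  qed
  then have "AE X in coin_measure. \<forall>i. X i \<in> {0, 1}" by (simp add: AE_all_countable)
  then show ?thesis by (rule eventually_mono) (simp add: cantor_def image_subset_iff)
qed

section \<open>Clopen measures by counting strings\<close>

definition level :: "nat \<Rightarrow> (nat list \<Rightarrow> bool) \<Rightarrow> (nat \<Rightarrow> nat) set" where
  "level n P = {X \<in> cantor. P (restr X n)}"

definition strings :: "nat \<Rightarrow> (nat list \<Rightarrow> bool) \<Rightarrow> nat list set" where
  "strings n P = {\<sigma> \<in> binary_strings. length \<sigma> = n \<and> P \<sigma>}"

lemma finite_strings [simp]: "finite (strings n P)"
  by (rule finite_subset[OF _ finite_lists_length_eq[of "{0,1}" n]])
    (auto simp: strings_def binary_strings_def)

lemma card_strings_True: "card (strings n (\<lambda>_. True)) = 2 ^ n"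
proof -
  have "strings n (\<lambda>_. True) = {\<sigma>. set \<sigma> \<subseteq> {0, 1} \<and> length \<sigma> = n}"
    by (auto simp: strings_def binary_strings_def)
  then show ?thesis using card_lists_length_eq[of "{0, 1 :: nat}" n] by (simp add: numeral_2_eq_2)
qed

lemma level_eq: "level n P = cantor \<inter> (\<Union>\<sigma>\<in>strings n P. cylinder \<sigma>)"
  by (auto simp: level_def strings_def in_cylinder_iff intro: restr_binary)

lemma level_sets [measurable]: "level n P \<in> sets coin_measure"
  unfolding level_eq by (intro sets.Int cantor_sets sets.finite_UN finite_strings cylinder_sets)

text \<open>Cylinders of distinct strings of length \<open>n\<close> are disjoint and have equal
  measure. Measure bounds on levels thereby become comparisons of computable counts.\<close>

lemma measure_level: "measure coin_measure (level n P) = card (strings n P) / 2 ^ n"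
proof -
  have U: "(\<Union>\<sigma>\<in>strings n P. cylinder \<sigma>) \<in> sets coin_measure"
    by (intro sets.finite_UN finite_strings cylinder_sets)
  have "measure coin_measure (level n P) = measure coin_measure (\<Union>\<sigma>\<in>strings n P. cylinder \<sigma>)"
    by (rule coin.finite_measure_eq_AE[OF _ level_sets U])
      (use AE_cantor in \<open>auto simp: level_eq elim: AE_mp\<close>)
  also have "\<dots> = (\<Sum>\<sigma>\<in>strings n P. measure coin_measure (cylinder \<sigma>))"
    by (intro coin.finite_measure_finite_Union finite_strings)
      (auto simp: cylinder_sets disjoint_family_on_def strings_def in_cylinder_iff)
  also have "\<dots> = (\<Sum>\<sigma>\<in>strings n P. (1 / 2) ^ n)"
    by (intro sum.cong) (auto simp: strings_def measure_cylinder)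
  finally show ?thesis by (simp add: power_divide)
qed

lemma measure_UN_le_sums:
  assumes E: "\<And>q. E q \<in> sets coin_measure" and le: "\<And>q. measure coin_measure (E q) \<le> a q"
    and a: "a sums s"
  shows "measure coin_measure (\<Union>q. E q) \<le> s"
proof -
  have sm: "summable (\<lambda>q. measure coin_measure (E q))"
    by (rule summable_comparison_test'[OF sums_summable[OF a], of 0]) (simp add: le)
  then have "measure coin_measure (\<Union>q. E q) \<le> (\<Sum>q. measure coin_measure (E q))"
    using E by (intro coin.finite_measure_subadditive_countably) auto
  also have "\<dots> \<le> suminf a" by (rule suminf_le[OF le sm sums_summable[OF a]])
  also have "\<dots> = s" using a by (simp add: sums_iff)
  finally show ?thesis .
qed

lemma half_power_sums: "(\<lambda>q. (1 / 2 :: real) ^ c * (1 / 2) ^ Suc q) sums (1 / 2) ^ c"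
  using sums_mult[OF power_half_series, of "(1 / 2) ^ c"] by (simp only: mult_1_right)

text \<open>Binary expansion, least significant digit first. It enumerates the binary strings of
  length \<open>n\<close> by the numbers below \<open>2 ^ n\<close>, so counting strings becomes a
  bounded sum.\<close>

definition bits :: "nat \<Rightarrow> nat \<Rightarrow> nat list" where
  "bits n v = map (\<lambda>j. v div 2 ^ j mod 2) [0..<n]"

lemma bits_eq_iff: "bits n v = bits n w \<longleftrightarrow> v mod 2 ^ n = w mod 2 ^ n"
proof (induction n)
  case (Suc n)
  have m: "u mod 2 ^ Suc n = 2 ^ n * (u div 2 ^ n mod 2) + u mod 2 ^ n" for u :: nat
    using mod_mult2_eq[of u "2 ^ n" 2] by (simp add: mult.commute)
  have eq: "2 ^ n * a + r = 2 ^ n * b + s \<longleftrightarrow> a = b \<and> r = s" if "r < 2 ^ n" "s < 2 ^ n" for a b r s :: nat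
  proof
    assume e: "2 ^ n * a + r = 2 ^ n * b + s"
    have "a = (2 ^ n * a + r) div 2 ^ n" using that by simp
    also have "\<dots> = b" using e that by simp
    finally show "a = b \<and> r = s" using e by simp
  qed simp
  have "bits (Suc n) u = bits n u @ [u div 2 ^ n mod 2]" for u by (simp add: bits_def)
  then have "bits (Suc n) v = bits (Suc n) w \<longleftrightarrow>
      bits n v = bits n w \<and> v div 2 ^ n mod 2 = w div 2 ^ n mod 2"
    by simp
  also have "\<dots> \<longleftrightarrow> v mod 2 ^ Suc n = w mod 2 ^ Suc n"
    unfolding m by (subst eq) (auto simp: Suc.IH)
  finally show ?case .
qed (simp add: bits_def)

lemma bits_bij: "bij_betw (bits n) {..<2 ^ n} (strings n (\<lambda>_. True))"
proof -
  have inj: "inj_on (bits n) {..<2 ^ n}" by (intro inj_onI) (simp add: bits_eq_iff)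
  have "bits n ` {..<2 ^ n} \<subseteq> strings n (\<lambda>_. True)"
    by (auto simp: strings_def binary_strings_def bits_def)
  then have "bits n ` {..<2 ^ n} = strings n (\<lambda>_. True)"
    by (intro card_subset_eq finite_strings) (simp_all add: card_image inj card_strings_True)
  with inj show ?thesis by (simp add: bij_betw_def)
qed

lemma card_strings: "card (strings n P) = (\<Sum>v<2 ^ n. if P (bits n v) then 1 else 0)"
proof -
  have "card (strings n P) = (\<Sum>\<sigma>\<in>strings n (\<lambda>_. True). if P \<sigma> then 1 else 0)"
  proof -
    have "strings n P = strings n (\<lambda>_. True) \<inter> {\<sigma>. P \<sigma>}" by (auto simp: strings_def)
    then show ?thesis using finite_strings by (simp add: sum.If_cases)
  qed
  also have "\<dots> = (\<Sum>v<2 ^ n. if P (bits n v) then 1 else 0)"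
    using sum.reindex_bij_betw[OF bits_bij[of n], of "\<lambda>\<sigma>. if P \<sigma> then 1 else 0 :: nat"] by simp
  finally show ?thesis .
qed

lemma cpt_card_strings [cpt]:
  assumes "dec (\<lambda>f z. P f (pl z) (list_decode (pr z)))" "cpt N"
  shows "cpt (\<lambda>f x. card (strings (N f x) (P f x)))"
proof -
  have "dec (\<lambda>f z. P f (pl z) (bits (N f (pl z)) (pr z)))"
  proof -
    have "cptl (\<lambda>f z. bits (N f (pl z)) (pr z))"
      unfolding bits_def by (intro cpt cpt_comp[OF assms(2)])
    from dec_app2[of "\<lambda>f a b. P f a (list_decode b)", OF assms(1) cpt_pl[OF cpt_id] cpt_encode[OF this]]
    show ?thesis by (simp only: list_encode_inverse)
  qed
  then show ?thesis unfolding card_strings by (intro cpt assms(2))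
qed

text \<open>There are countably many tests, one for each index satisfying the measure bounds, and
  each has a null intersection. Naming a null superset sidesteps the measurability of
  \<open>two_random\<close>.\<close>

lemma two_random_full: "\<exists>Z\<in>null_sets coin_measure. cantor - two_random \<subseteq> Z"
proof -
  define U where "U e n = open_generated {\<sigma>. prod_encode (n, list_encode \<sigma>) \<in> W_rel halting_oracle e}" for e n
  define T where "T = {e. \<forall>n. measure coin_measure (U e n) \<le> (1 / 2) ^ n}"
  have U: "U e n \<in> sets coin_measure" for e n unfolding U_def by (rule open_generated_sets)
  have "(\<Inter>n. U e n) \<in> null_sets coin_measure" if "e \<in> T" for e
  proof -
    have I: "(\<Inter>n. U e n) \<in> sets coin_measure" using U by blast
    have "measure coin_measure (\<Inter>n. U e n) \<le> (1 / 2) ^ n" for n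
      using that coin.finite_measure_mono[of "\<Inter>n. U e n" "U e n"] U unfolding T_def
      by (smt (verit) INT_lower UNIV_I mem_Collect_eq)
    moreover have "(\<lambda>n. (1 / 2 :: real) ^ n) \<longlonglongrightarrow> 0" by (rule LIMSEQ_realpow_zero) auto
    ultimately have "measure coin_measure (\<Inter>n. U e n) \<le> 0"
      by (intro LIMSEQ_le_const) auto
    then have "measure coin_measure (\<Inter>n. U e n) = 0" by (simp add: measure_le_0_iff)
    with I show ?thesis by (auto simp: null_sets_def coin.emeasure_eq_measure)
  qed
  then have "(\<Union>e\<in>T. \<Inter>n. U e n) \<in> null_sets coin_measure"
    by (intro null_sets_UN') auto
  moreover have "cantor - two_random \<subseteq> (\<Union>e\<in>T. \<Inter>n. U e n)"
  proof
    fix X assume "X \<in> cantor - two_random"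
    then obtain V where V: "martin_loef_test halting_oracle V" "X \<in> (\<Inter>n. V n)"
      unfolding two_random_def martin_loef_random_def by blast
    then obtain e where "V = U e" unfolding martin_loef_test_def U_def by blast
    moreover have "e \<in> T" using V(1) \<open>V = U e\<close> unfolding martin_loef_test_def T_def by blast
    ultimately show "X \<in> (\<Union>e\<in>T. \<Inter>n. U e n)" using V(2) by blast
  qed
  ultimately show ?thesis by blast
qed

lemma AE_two_random: "AE X in coin_measure. X \<in> two_random"
proof -
  obtain Z where "Z \<in> null_sets coin_measure" "cantor - two_random \<subseteq> Z"
    using two_random_full by blast
  then have "AE X in coin_measure. X \<notin> Z" by (simp add: AE_not_in)
  with AE_cantor show ?thesis
    by eventually_elim (use \<open>cantor - two_random \<subseteq> Z\<close> in blast)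
qed

section \<open>Clopen sets as decidable properties of strings\<close>

lemma clopen_of_cases:
  fixes k :: nat
  obtains "k mod 3 = 0" "clopen_of k = Cyl (list_decode (k div 3))"
  | "k mod 3 = 1" "clopen_of k = Neg (clopen_of (k div 3))" "k div 3 < k"
  | "k mod 3 = 2" "clopen_of k = Conj (clopen_of (pl (k div 3))) (clopen_of (pr (k div 3)))"
    "pl (k div 3) < k" "pr (k div 3) < k"
proof -
  have "k mod 3 < 3" by simp
  then consider "k mod 3 = 0" | "k mod 3 = 1" | "k mod 3 = 2" by linarith
  then show thesis
  proof cases
    case 1
    then show thesis using that(1) clopen_of.simps[of k] by (simp add: Let_def)
  next
    case 2
    then have "k \<noteq> 0" by auto
    then have "k div 3 < k" by simp
    with 2 show thesis using that(2) clopen_of.simps[of k] by (simp add: Let_def)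
  next
    case 3
    then have "k \<noteq> 0" by auto
    then have "k div 3 < k" by simp
    with pl_le[of "k div 3"] pr_le[of "k div 3"] have "pl (k div 3) < k" "pr (k div 3) < k"
      by linarith+
    with 3 show thesis using that(3) clopen_of.simps[of k]
      by (simp add: Let_def pl_def pr_def)
  qed
qed

definition in_clopen :: "nat \<Rightarrow> (nat \<Rightarrow> nat) \<Rightarrow> bool" where
  "in_clopen k f \<longleftrightarrow> f \<in> clopen_sem (clopen_of k)"

lemma restr_take: "k \<le> n \<Longrightarrow> restr f k = take k (restr f n)"
  by (simp add: restr_def take_map min_def)

text \<open>All strings in the expression with code \<open>k\<close> have length at most
  \<open>k\<close>, so the first \<open>k\<close> values of the input decide membership.\<close>

lemma in_clopen_cong:
  "restr f n = restr g n \<Longrightarrow> k \<le> n \<Longrightarrow> in_clopen k f \<longleftrightarrow> in_clopen k g"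
proof (induction k rule: less_induct)
  case (less k)
  show ?case
  proof (cases rule: clopen_of_cases[of k])
    case 1
    have "length (list_decode (k div 3)) \<le> n"
      using length_list_decode_le[of "k div 3"] div_le_dividend[of k 3] less.prems(2) by linarith
    then show ?thesis using 1(2) less.prems(1)
      by (simp add: in_clopen_def in_cylinder_iff restr_take[of "length (list_decode (k div 3))" n])
  next
    case 2
    then show ?thesis using less.IH[of "k div 3"] less.prems by (simp add: in_clopen_def)
  next
    case 3
    then show ?thesis
      using less.IH[of "pl (k div 3)"] less.IH[of "pr (k div 3)"] less.prems by (simp add: in_clopen_def)
  qed
qed

lemma restr_nthd_restr: "restr (nthd (restr f n)) n = restr f n"
  by (simp add: restr_def nthd_def)

lemma restr_nthd: "restr (nthd \<sigma>) (length \<sigma>) = \<sigma>"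
  by (rule nth_equalityI) (simp_all add: restr_def nthd_def)

lemma cptl_rec:
  assumes "cptl A" "cptl (\<lambda>f z. D f (pl z) (pl (pr z)) (list_decode (pr (pr z))))" "cpt N"
  shows "cptl (\<lambda>f x. rec_nat (A f x) (D f x) (N f x))"
proof -
  have r: "rec_nat (list_encode a) (\<lambda>m r. list_encode (d m (list_decode r))) n = list_encode (rec_nat a d n)"
    for a n and d :: "nat \<Rightarrow> nat list \<Rightarrow> nat list" by (induction n) auto
  have "cpt (\<lambda>f x. rec_nat (list_encode (A f x)) (\<lambda>m r. list_encode (D f x m (list_decode r))) (N f x))"
    using assms unfolding cptl_def by (intro cpt_rec)
  then show ?thesis unfolding cptl_def by (simp add: r)
qed

lemma nthd_snoc: "nthd (r @ [v]) k = (if k = length r then v else nthd r k)"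
  by (auto simp: nthd_def nth_append)

definition clopen_entry :: "nat list \<Rightarrow> nat \<Rightarrow> nat list \<Rightarrow> nat" where
  "clopen_entry \<sigma> m r =
    (if m mod 3 = 0 then
       if map (nthd \<sigma>) [0..<length (list_decode (m div 3))] = list_decode (m div 3) then 1 else 0
     else if m mod 3 = 1 then 1 - nthd r (m div 3)
     else nthd r (pl (m div 3)) * nthd r (pr (m div 3)))"

text \<open>Course-of-values recursion: subexpressions have smaller codes, so their truth values
  already stand in the table when entry \<open>m\<close> is computed.\<close>

definition clopen_table :: "nat list \<Rightarrow> nat \<Rightarrow> nat list" where
  "clopen_table \<sigma> n = rec_nat [] (\<lambda>m r. r @ [clopen_entry \<sigma> m r]) n"

lemma clopen_table:
  "length (clopen_table \<sigma> n) = n \<and>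
   (\<forall>k<n. nthd (clopen_table \<sigma> n) k = (if in_clopen k (nthd \<sigma>) then 1 else 0))"
proof (induction n)
  case (Suc n)
  let ?r = "clopen_table \<sigma> n"
  have "clopen_entry \<sigma> n ?r = (if in_clopen n (nthd \<sigma>) then 1 else 0)"
    by (cases rule: clopen_of_cases[of n])
      (use Suc in \<open>auto simp: clopen_entry_def in_clopen_def in_cylinder_iff restr_def\<close>)
  moreover have "clopen_table \<sigma> (Suc n) = ?r @ [clopen_entry \<sigma> n ?r]"
    by (simp add: clopen_table_def)
  ultimately show ?case using Suc
    by (auto simp: nthd_snoc)
qed (simp add: clopen_table_def)

lemma dec_in_clopen [cpt]:
  assumes "cptl S" "cpt K" shows "dec (\<lambda>f x. in_clopen (K f x) (nthd (S f x)))"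
proof -
  have "cptl (\<lambda>f z. clopen_table (list_decode (pl z)) (Suc (pr z)))"
    unfolding clopen_table_def clopen_entry_def by (intro cptl_rec cpt cptl_decode[OF cpt_const[of 0], simplified])
  then have "dec (\<lambda>f z. nthd (clopen_table (list_decode (pl z)) (Suc (pr z))) (pr z) = 1)"
    by (intro cpt)
  then have "dec (\<lambda>f z. in_clopen (pr z) (nthd (list_decode (pl z))))"
    by (rule dec_cong) (simp add: clopen_table)
  from dec_app2[of "\<lambda>f a b. in_clopen b (nthd (list_decode a))", OF this assms(1)[unfolded cptl_def] assms(2)]
  show ?thesis by simp
qed

section \<open>No reduction through closed sets\<close>

text \<open>Decidable approximation to \<open>Pi_class 1 j\<close>: no removed clopen set discovered
  so far contains the string. Since \<open>k < length \<sigma>\<close>, the padding by zeros does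
  not influence the answer.\<close>

definition good :: "nat \<Rightarrow> nat list \<Rightarrow> bool" where
  "good j \<sigma> \<longleftrightarrow> (\<forall>k<length \<sigma>. \<forall>w<length \<sigma>. halts_by j k w \<longrightarrow> \<not> in_clopen k (nthd \<sigma>))"

definition outputs :: "nat \<Rightarrow> nat list \<Rightarrow> nat list \<Rightarrow> bool" where
  "outputs e \<tau> \<sigma> \<longleftrightarrow> (\<forall>x<length \<tau>. \<exists>l<length \<sigma>. certifies \<sigma> e x (nthd \<tau> x) l)"

definition converges :: "nat \<Rightarrow> nat \<Rightarrow> nat list \<Rightarrow> bool" where
  "converges e m \<sigma> \<longleftrightarrow> (\<forall>x<m. \<exists>y<length \<sigma>. \<exists>l<length \<sigma>. certifies \<sigma> e x y l)"

text \<open>The bounds sum to at most \<open>2\<close> to the power \<open>-c\<close> over all \<open>\<sigma>\<close>, since \<open>\<sigma>\<close> enters through its code.\<close>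

definition sparse_ext :: "nat \<Rightarrow> nat \<Rightarrow> nat \<Rightarrow> nat list \<Rightarrow> nat \<Rightarrow> nat list \<Rightarrow> bool" where
  "sparse_ext e j c \<sigma> n \<tau> \<longleftrightarrow>
     \<tau> \<in> binary_strings \<and> prefix \<sigma> \<tau> \<and> length \<tau> = length \<sigma> + (list_encode \<sigma> + c + 2) \<and>
     card (strings n (\<lambda>\<rho>. good j \<rho> \<and> outputs e \<tau> \<rho>)) * 2 ^ (list_encode \<sigma> + c + 2) \<le> 2 ^ n \<and>
     card (strings n (\<lambda>\<rho>. good j \<rho> \<and> \<not> converges e (length \<tau>) \<rho>)) * 2 ^ (list_encode \<sigma> + c + 2) \<le> 2 ^ n"

lemma good_restr:
  "X \<in> Pi_class 1 j \<longleftrightarrow> (\<forall>n. good j (restr X n))"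
proof -
  have "in_clopen k (nthd (restr X n)) \<longleftrightarrow> in_clopen k X" if "k < n" for k n
    using in_clopen_cong[OF restr_nthd_restr[of X n], of k] that by simp
  then have "(\<forall>n. good j (restr X n)) \<longleftrightarrow> (\<forall>n. \<forall>k<n. \<forall>w<n. halts_by j k w \<longrightarrow> \<not> in_clopen k X)"
    unfolding good_def by simp
  also have "\<dots> \<longleftrightarrow> (\<forall>k w. halts_by j k w \<longrightarrow> \<not> in_clopen k X)"
    by (metis less_Suc_eq_le max.cobounded1 max.cobounded2)
  also have "\<dots> \<longleftrightarrow> X \<in> Pi_class 1 j"
    unfolding One_nat_def Pi_class.simps by (auto simp: W_iff_halts_by in_clopen_def)
  finally show ?thesis by simp
qed

lemma good_mono:
  assumes "good j (restr X n)" "m \<le> n" shows "good j (restr X m)"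
proof -
  have "in_clopen k (nthd (restr X i)) \<longleftrightarrow> in_clopen k X" if "k < i" for k i
    using in_clopen_cong[OF restr_nthd_restr[of X i], of k] that by simp
  with assms show ?thesis unfolding good_def by (simp, meson less_le_trans)
qed

lemma converges_mono:
  assumes "converges e m (restr X n)" "n \<le> n'" shows "converges e m (restr X n')"
  using assms certifies_mono[OF _ prefix_restr[OF assms(2)]] unfolding converges_def
  by simp (meson less_le_trans)

text \<open>The sets decrease with \<open>n\<close>. A point of their intersection lies in the class
  but never receives its first \<open>m\<close> outputs, so by \<open>H\<close> it is not 2-random;
  the intersection is null and continuity from above applies.\<close>

lemma measure_nonconvergent:
  assumes H: "\<forall>f\<in>two_random \<inter> Pi_class 1 j. Phi_in e f one_generic"
  shows "(\<lambda>n. measure coin_measure (level n (\<lambda>\<rho>. good j \<rho> \<and> \<not> converges e m \<rho>))) \<longlonglongrightarrow> 0"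
proof -
  let ?D = "\<lambda>n. level n (\<lambda>\<rho>. good j \<rho> \<and> \<not> converges e m \<rho>)"
  have "decseq ?D"
    unfolding decseq_def level_def by (auto intro: good_mono converges_mono)
  then have lim: "(\<lambda>n. measure coin_measure (?D n)) \<longlonglongrightarrow> measure coin_measure (\<Inter>n. ?D n)"
    by (intro coin.finite_Lim_measure_decseq) auto
  have no: "X \<notin> two_random" if "X \<in> (\<Inter>n. ?D n)" for X
  proof
    assume X: "X \<in> two_random"
    have "X \<in> Pi_class 1 j" using that unfolding good_restr level_def by blast
    with X H obtain g where g: "\<And>x. Phi e X x = Some (g x)" unfolding Phi_in_def by blast
    then have "\<forall>x. \<exists>k l. certifies (restr X k) e x (g x) l" using certifies_complete by blast
    then obtain k l where kl: "\<And>x. certifies (restr X (k x)) e x (g x) (l x)" by metis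
    \<comment> \<open>A sum bounds all the oracle uses and certificates for \<open>x < m\<close>
      simultaneously.\<close>
    define n where "n = (\<Sum>x<m. Suc (k x + l x))"
    have "\<exists>y<n. \<exists>i<n. certifies (restr X n) e x y i" if "x < m" for x
    proof -
      have "Suc (k x + l x) \<le> n" unfolding n_def using that by (intro member_le_sum) auto
      then have "certifies (restr X n) e x (g x) (l x)" "l x < n"
        using certifies_mono[OF kl prefix_restr] by simp_all
      moreover have "g x < l x" using kl by (rule certifies_less)
      ultimately show ?thesis by (meson less_trans)
    qed
    then have "converges e m (restr X n)" unfolding converges_def by simp
    with that show False unfolding level_def by blast
  qed
  have "AE X in coin_measure. X \<notin> (\<Inter>n. ?D n)"
    using AE_two_random by eventually_elim (use no in blast)
  then have "measure coin_measure (\<Inter>n. ?D n) = 0"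
    by (intro coin.prob_eq_0[THEN iffD2]) auto
  with lim show ?thesis by simp
qed

text \<open>The padded string is a genuine oracle on which the certificates are sound, so
  determinism of \<open>Phi\<close> applies.\<close>

lemma outputs_unique:
  assumes "outputs e \<tau> \<sigma>" "outputs e \<tau>' \<sigma>" "length \<tau> = length \<tau>'" shows "\<tau> = \<tau>'"
proof (rule nth_equalityI)
  fix x assume x: "x < length \<tau>"
  have s: "Phi e (nthd \<sigma>) x = Some y" if "certifies \<sigma> e x y l" for y l
    using certifies_sound[of "nthd \<sigma>" "length \<sigma>"] that by (simp add: restr_nthd)
  obtain l l' where "certifies \<sigma> e x (nthd \<tau> x) l" "certifies \<sigma> e x (nthd \<tau>' x) l'"
    using assms x unfolding outputs_def by metis
  then have "Some (nthd \<tau> x) = Some (nthd \<tau>' x)" using s by metis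
  then have "nthd \<tau> x = nthd \<tau>' x" by simp
  with x assms(3) show "\<tau> ! x = \<tau>' ! x" by (simp add: nthd_def)
qed (use assms in simp)

text \<open>Pigeonhole: by \<open>outputs_unique\<close>, inputs mapped above different extensions
  of the same length form disjoint sets, so one of the \<open>2 ^ b\<close> extensions receives at
  most the fraction \<open>1 / 2 ^ b\<close> of all strings. The bound on nonconvergence holds once
  \<open>n\<close> is large.\<close>

lemma ex_sparse_ext:
  assumes H: "\<forall>f\<in>two_random \<inter> Pi_class 1 j. Phi_in e f one_generic"
    and \<sigma>: "\<sigma> \<in> binary_strings"
  shows "\<exists>n \<tau>. sparse_ext e j c \<sigma> n \<tau>"
proof -
  define b where "b = list_encode \<sigma> + c + 2"
  define m where "m = length \<sigma> + b"
  let ?A = "\<lambda>n \<rho>. strings n (\<lambda>\<rho>'. good j \<rho>' \<and> outputs e (\<sigma> @ \<rho>) \<rho>')"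
  have "eventually (\<lambda>n. measure coin_measure (level n (\<lambda>\<rho>. good j \<rho> \<and> \<not> converges e m \<rho>)) < (1/2)^b) sequentially"
    using measure_nonconvergent[OF H, of m] by (rule order_tendstoD) auto
  then obtain n where "measure coin_measure (level n (\<lambda>\<rho>. good j \<rho> \<and> \<not> converges e m \<rho>)) < (1/2)^b"
    using eventually_happens by fastforce
  then have "real (card (strings n (\<lambda>\<rho>. good j \<rho> \<and> \<not> converges e m \<rho>)) * 2 ^ b) < 2 ^ n"
    unfolding measure_level by (simp add: field_simps power_divide)
  then have n: "card (strings n (\<lambda>\<rho>. good j \<rho> \<and> \<not> converges e m \<rho>)) * 2 ^ b \<le> 2 ^ n"
    by (metis less_imp_le of_nat_less_numeral_power_cancel_iff)
  have "\<exists>\<rho>\<in>strings b (\<lambda>_. True). card (?A n \<rho>) * 2 ^ b \<le> 2 ^ n"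
  proof (rule ccontr)
    assume "\<not> ?thesis"
    then have "(\<Sum>\<rho>\<in>strings b (\<lambda>_. True). 2 ^ n) < (\<Sum>\<rho>\<in>strings b (\<lambda>_. True). card (?A n \<rho>) * 2 ^ b)"
      using card_strings_True[of b] by (intro sum_strict_mono) (auto simp: not_le)
    also have "\<dots> = card (\<Union>\<rho>\<in>strings b (\<lambda>_. True). ?A n \<rho>) * 2 ^ b"
    proof -
      have disj: "\<rho> = \<rho>'" if "\<rho> \<in> strings b (\<lambda>_. True)" "\<rho>' \<in> strings b (\<lambda>_. True)"
        "x \<in> ?A n \<rho>" "x \<in> ?A n \<rho>'" for \<rho> \<rho>' x
        using outputs_unique[of e "\<sigma> @ \<rho>" x "\<sigma> @ \<rho>'"] that by (auto simp: strings_def)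
      then have "card (\<Union>\<rho>\<in>strings b (\<lambda>_. True). ?A n \<rho>) = (\<Sum>\<rho>\<in>strings b (\<lambda>_. True). card (?A n \<rho>))"
        by (intro card_UN_disjoint finite_strings ballI) (use disj in \<open>simp, blast\<close>)
      then show ?thesis by (simp add: sum_distrib_right)
    qed
    also have "card (\<Union>\<rho>\<in>strings b (\<lambda>_. True). ?A n \<rho>) \<le> card (strings n (\<lambda>_. True))"
      by (intro card_mono finite_strings) (auto simp: strings_def)
    finally show False by (simp add: card_strings_True mult.commute)
  qed
  then obtain \<rho> where \<rho>: "\<rho> \<in> strings b (\<lambda>_. True)" "card (?A n \<rho>) * 2 ^ b \<le> 2 ^ n" by blast
  then have "sparse_ext e j c \<sigma> n (\<sigma> @ \<rho>)"
    using n \<sigma> unfolding sparse_ext_def b_def[symmetric] m_def by (auto simp: strings_def binary_strings_def)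
  then show ?thesis by blast
qed

lemma dec_sparse_ext:
  "dec (\<lambda>f z. sparse_ext e j c (list_decode (pl z)) (pl (pr z)) (list_decode (pr (pr z))))"
  unfolding sparse_ext_def good_def outputs_def converges_def by (intro cpt)

text \<open>For each \<open>c\<close> the sparse extensions form a dense c.e. set \<open>S\<close>,
  so a 1-generic output has a prefix in \<open>S\<close>. By sparseness this confines almost all of
  the class to a set of measure at most \<open>(1/2) ^ c\<close>.\<close>

lemma no_closed_reduction:
  assumes H: "\<forall>f\<in>two_random \<inter> Pi_class 1 j. Phi_in e f one_generic"
  shows "AE X in coin_measure. X \<notin> Pi_class 1 j"
proof -
  let ?V = "\<Inter>n. level n (good j)"
  have bound: "measure coin_measure ?V \<le> (1/2) ^ c" for c
  proof -
    \<comment> \<open>Taking the least code selects a single extension for each \<open>q\<close>;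
      the measure bounds are summed over \<open>q\<close> and allow only one.\<close>
    define z where "z q = (LEAST z. sparse_ext e j c (list_decode q) (pl z) (list_decode (pr z)))" for q
    have z: "sparse_ext e j c (list_decode q) (pl (z q)) (list_decode (pr (z q)))"
      if q: "list_decode q \<in> binary_strings" for q
    proof -
      obtain n \<tau> where "sparse_ext e j c (list_decode q) n \<tau>" using ex_sparse_ext[OF H q] by blast
      then have "sparse_ext e j c (list_decode q) (pl (pp n (list_encode \<tau>))) (list_decode (pr (pp n (list_encode \<tau>))))"
        by simp
      then show ?thesis unfolding z_def by (rule LeastI)
    qed
    define S where "S = {\<tau>. \<exists>q. list_decode q \<in> binary_strings \<and> \<tau> = list_decode (pr (z q))}"
    have "ce_strings S"
    proof -
      \<comment> \<open>The witness \<open>n\<close> pairs \<open>q\<close> with a candidate for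
        \<open>z q\<close>; minimality is checked by a bounded search.\<close>
      let ?P = "\<lambda>x n. list_decode (pl n) \<in> binary_strings \<and>
          sparse_ext e j c (list_decode (pl n)) (pl (pr n)) (list_decode (pr (pr n))) \<and>
          (\<forall>z<pr n. \<not> sparse_ext e j c (list_decode (pl n)) (pl z) (list_decode (pr z))) \<and> x = pr (pr n)"
      have "dec (\<lambda>f z. ?P (pl z) (pr z))"
        by (intro cpt
          dec_comp[OF dec_sparse_ext, of "\<lambda>f z. pp (pl (pr z)) (pr (pr z))", simplified]
          dec_comp[OF dec_sparse_ext, of "\<lambda>f z. pp (pl (pr (pl z))) (pr z)", simplified])
      then obtain d where "\<And>f x. x \<in> W_rel f d \<longleftrightarrow> (\<exists>n. ?P x n)" using dec_ce[of "\<lambda>f. ?P"] by blast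
      then have "x \<in> W_rel no_oracle d \<longleftrightarrow> x \<in> list_encode ` S" for x
      proof -
        have "(\<exists>n. ?P x n) \<longleftrightarrow> (\<exists>q. list_decode q \<in> binary_strings \<and> x = pr (z q))"
        proof
          assume "\<exists>n. ?P x n"
          then obtain n where n: "?P x n" by blast
          then have "z (pl n) = pr n" unfolding z_def by (intro Least_equality) (auto simp: not_less[symmetric])
          with n show "\<exists>q. list_decode q \<in> binary_strings \<and> x = pr (z q)" by auto
        next
          assume "\<exists>q. list_decode q \<in> binary_strings \<and> x = pr (z q)"
          then obtain q where q: "list_decode q \<in> binary_strings" "x = pr (z q)" by blast
          have "\<forall>z'<z q. \<not> sparse_ext e j c (list_decode q) (pl z') (list_decode (pr z'))"
            unfolding z_def using not_less_Least by blast
          then have "?P x (pp q (z q))" using q z[OF q(1)] by simp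
          then show "\<exists>n. ?P x n" by blast
        qed
        also have "\<dots> \<longleftrightarrow> x \<in> list_encode ` S" unfolding S_def by force
        finally show ?thesis using \<open>\<And>f x. x \<in> W_rel f d \<longleftrightarrow> (\<exists>n. ?P x n)\<close> by simp
      qed
      then show ?thesis unfolding ce_strings_def by (metis subsetI subset_antisym)
    qed
    have S_sub: "S \<subseteq> binary_strings" unfolding S_def using z by (auto simp: sparse_ext_def)
    \<comment> \<open>Points whose output is seen to extend the chosen string, together with those
      whose output is not yet long enough at level \<open>pl (z q)\<close>. Each part has measure at
      most \<open>(1/2) ^ (q + c + 2)\<close>.\<close>
    define E where "E q = (if list_decode q \<in> binary_strings then
        level (pl (z q)) (\<lambda>\<rho>. good j \<rho> \<and> outputs e (list_decode (pr (z q))) \<rho>) \<union>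
        level (pl (z q)) (\<lambda>\<rho>. good j \<rho> \<and> \<not> converges e (length (list_decode (pr (z q)))) \<rho>) else {})" for q
    have E_sets: "E q \<in> sets coin_measure" for q unfolding E_def by auto
    have E_measure: "measure coin_measure (E q) \<le> (1/2) ^ c * (1/2) ^ Suc q" for q
    proof (cases "list_decode q \<in> binary_strings")
      case True
      define b where "b = q + c + 2"
      let ?A = "\<lambda>\<rho>. good j \<rho> \<and> outputs e (list_decode (pr (z q))) \<rho>"
      let ?B = "\<lambda>\<rho>. good j \<rho> \<and> \<not> converges e (length (list_decode (pr (z q)))) \<rho>"
      let ?n = "pl (z q)"
      have le: "card (strings ?n ?A) * 2 ^ b \<le> 2 ^ ?n" "card (strings ?n ?B) * 2 ^ b \<le> 2 ^ ?n"
        using z[OF True] unfolding sparse_ext_def b_def list_decode_inverse by blast+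
      have q: "measure coin_measure (level ?n P) \<le> (1/2) ^ b" if "card (strings ?n P) * 2 ^ b \<le> 2 ^ ?n" for P
      proof -
        have "real (card (strings ?n P) * 2 ^ b) \<le> real (2 ^ ?n)" using that by (simp only: of_nat_le_iff)
        then show ?thesis by (simp add: measure_level field_simps power_divide)
      qed
      have "measure coin_measure (E q) \<le> measure coin_measure (level ?n ?A) + measure coin_measure (level ?n ?B)"
        unfolding E_def using True by (simp add: measure_Un_le)
      also have "\<dots> \<le> (1/2) ^ b + (1/2) ^ b" using q[OF le(1)] q[OF le(2)] by linarith
      also have "\<dots> = (1/2) ^ c * (1/2) ^ Suc q" by (simp add: b_def power_add)
      finally show ?thesis .
    qed (simp add: E_def)
    have "X \<in> (\<Union>q. E q)" if X: "X \<in> two_random" "X \<in> ?V" for X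
    proof -
      have XV: "X \<in> Pi_class 1 j" using X(2) unfolding good_restr level_def by blast
      have good: "good j (restr X n)" for n using XV unfolding good_restr by blast
      have Xc: "X \<in> cantor" using X(2) unfolding level_def by blast
      obtain g where g: "g \<in> one_generic" "\<And>x. Phi e X x = Some (g x)"
        using H X(1) XV unfolding Phi_in_def by blast
      obtain k where k: "restr g k \<in> S \<or> \<not> (\<exists>\<tau>\<in>S. prefix (restr g k) \<tau>)"
        using g(1) S_sub \<open>ce_strings S\<close> unfolding one_generic_def by blast
      have "restr g k \<in> binary_strings" using g(1) by (intro restr_binary) (simp add: one_generic_def)
      then have qb: "list_decode (list_encode (restr g k)) \<in> binary_strings" by simp
      \<comment> \<open>The extension chosen for \<open>restr g k\<close> itself belongs to
        \<open>S\<close>, which rules out the second alternative of genericity.\<close>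
      let ?\<tau> = "list_decode (pr (z (list_encode (restr g k))))"
      have "?\<tau> \<in> S" unfolding S_def using qb by blast
      moreover have "prefix (restr g k) ?\<tau>" using z[OF qb] by (simp add: sparse_ext_def)
      ultimately have "\<exists>\<tau>\<in>S. prefix (restr g k) \<tau>" by blast
      with k obtain q where q: "list_decode q \<in> binary_strings" "restr g k = list_decode (pr (z q))"
        unfolding S_def by blast
      then have len: "length (list_decode (pr (z q))) = k" by (metis length_restr)
      let ?n = "pl (z q)"
      \<comment> \<open>Soundness of certificates leaves the values of \<open>g\<close> as the only
        possible outputs.\<close>
      have "outputs e (restr g k) (restr X ?n)" if "converges e k (restr X ?n)"
        unfolding outputs_def
      proof (intro allI impI)
        fix x assume "x < length (restr g k)"
        then have x: "x < k" by simp
        then obtain y l where yl: "l < length (restr X ?n)" "certifies (restr X ?n) e x y l"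
          using \<open>converges e k (restr X ?n)\<close> unfolding converges_def by blast
        have "y = g x" using certifies_sound[OF yl(2)] g(2)[of x] by simp
        with yl x show "\<exists>l<length (restr X ?n). certifies (restr X ?n) e x (nthd (restr g k) x) l"
          by (auto simp: nthd_restr)
      qed
      then have "X \<in> E q"
        using good Xc q len unfolding E_def level_def by (cases "converges e k (restr X ?n)") auto
      then show ?thesis by blast
    qed
    then have "measure coin_measure ?V \<le> measure coin_measure (\<Union>q. E q)"
      using AE_two_random E_sets
      by (intro coin.finite_measure_mono_AE) (auto elim!: eventually_mono)
    also have "\<dots> \<le> (1/2) ^ c"
      by (rule measure_UN_le_sums[OF E_sets E_measure half_power_sums])
    finally show ?thesis .
  qed
  have "measure coin_measure ?V \<le> 0"
    by (rule LIMSEQ_le_const[OF LIMSEQ_realpow_zero[of "1/2 :: real"]]) (use bound in auto)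
  then have "AE X in coin_measure. X \<notin> ?V"
    by (intro coin.prob_eq_0[THEN iffD1]) (auto simp: measure_le_0_iff)
  with AE_cantor show ?thesis
    by eventually_elim (unfold good_restr level_def, blast)
qed

text \<open>Index \<open>3 * i + 1\<close> denotes the complement of the clopen set
  \<open>i\<close>; removing this one set leaves the given class.\<close>

lemma clopen_Pi_class: "\<exists>j. Pi_class 0 i = Pi_class 1 j"
proof -
  obtain j where j: "\<And>f x. x \<in> W_rel f j \<longleftrightarrow> (\<exists>n::nat. x = 3 * i + 1)"
    using dec_ce[of "\<lambda>f x n. x = 3 * i + 1", OF dec_eq[OF cpt_pl[OF cpt_id] cpt_const]] by blast
  have "(3 * i + 1) div 3 = i" "(3 * i + 1) mod 3 = 1" by presburger+
  then have "clopen_of (3 * i + 1) = Neg (clopen_of i)"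
    by (subst clopen_of.simps) (simp only: Let_def, simp)
  moreover have "W_rel no_oracle j = {3 * i + 1}" using j by auto
  ultimately have "Pi_class 0 i = Pi_class 1 j" by simp
  then show ?thesis by blast
qed

text \<open>Each class of the cover is null by \<open>no_closed_reduction\<close>, and countably
  many null classes cannot cover a set of full measure.\<close>

lemma not_uniform_reducible:
  assumes "n \<le> 1" shows "\<not> uniform_reducible n one_generic two_random"
proof
  assume "uniform_reducible n one_generic two_random"
  then obtain V e where V: "uniformly_Pi n V" "two_random \<subseteq> (\<Union>i. V i)"
    "\<And>i f. f \<in> two_random \<inter> V i \<Longrightarrow> Phi_in (e i) f one_generic"
    unfolding uniform_reducible_def by blast
  have "\<exists>j. V i = Pi_class 1 j" for i
  proof -
    obtain k where k: "V i = Pi_class n k" using V(1) unfolding uniformly_Pi_def by blast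
    show ?thesis
    proof (cases "n = 0")
      case True
      then show ?thesis using k clopen_Pi_class[of k] by simp
    next
      case False
      then have "n = 1" using assms by simp
      then show ?thesis using k by blast
    qed
  qed
  then have "AE X in coin_measure. X \<notin> V i" for i
    using no_closed_reduction[of _ "e i"] V(3)[of _ i] by metis
  then have "AE X in coin_measure. \<forall>i. X \<notin> V i" by (simp add: AE_all_countable)
  with AE_two_random have "AE X in coin_measure. False"
    by eventually_elim (use V(2) in blast)
  then show False by (simp add: coin.AE_False)
qed

section \<open>Building a generic set from random guesses\<close>

text \<open>Reading the bits at the positions \<open>pp e j\<close> keeps the blocks of distinct
  requirements disjoint. The list code is injective in the block, and this is what the later
  counting uses.\<close>

definition guess :: "nat \<Rightarrow> (nat \<Rightarrow> nat) \<Rightarrow> nat \<Rightarrow> nat" where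
  "guess i X e = list_encode (map (\<lambda>j. X (pp e j)) [0..<Suc (e + i)])"

text \<open>The witness \<open>w\<close> codes an extension of \<open>\<rho>\<close> and a certificate for its membership in \<open>W\<^sub>e\<close>.\<close>

definition extends_by :: "nat \<Rightarrow> nat list \<Rightarrow> nat \<Rightarrow> bool" where
  "extends_by e \<rho> w \<longleftrightarrow> list_decode (pl w) \<in> binary_strings \<and> prefix \<rho> (list_decode (pl w)) \<and>
     halts_by e (pl w) (pr w)"

text \<open>A state codes the current output and a list whose entry \<open>e\<close> codes the number of errors made for
  requirement \<open>e\<close> together with the string last recorded for it; missing entries read as \<open>(0, [])\<close>.\<close>

definition out :: "nat \<Rightarrow> nat list" where
  "out s = list_decode (pl s)"

definition cnt :: "nat \<Rightarrow> nat \<Rightarrow> nat" where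
  "cnt s e = pl (nthd (list_decode (pr s)) e)"

definition mark :: "nat \<Rightarrow> nat \<Rightarrow> nat list" where
  "mark s e = list_decode (pr (nthd (list_decode (pr s)) e))"

text \<open>The appended \<open>0\<close> makes the output grow at every such stage, and the table
  is lengthened so that entry \<open>e\<close> exists.\<close>

definition advance :: "nat \<Rightarrow> nat \<Rightarrow> nat list \<Rightarrow> nat list \<Rightarrow> nat" where
  "advance s e \<tau> \<mu> = pp (list_encode (\<tau> @ [0]))
     (list_encode (map (\<lambda>j. if j = e then pp (Suc (cnt s e)) (list_encode \<mu>)
        else nthd (list_decode (pr s)) j) [0..<Suc (e + length (list_decode (pr s)))]))"

text \<open>Stage \<open>p\<close> serves requirement \<open>pl p\<close>, so every requirement
  recurs infinitely often. It acts when a witness below \<open>p\<close> refutes the belief about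
  the mark; a count above the guess means that the requirement has been met.\<close>

definition attempt :: "nat \<Rightarrow> (nat \<Rightarrow> nat) \<Rightarrow> nat \<Rightarrow> nat \<Rightarrow> bool" where
  "attempt i X p s \<longleftrightarrow> cnt s (pl p) \<le> guess i X (pl p) \<and> (\<exists>w<p. extends_by (pl p) (mark s (pl p)) w)"

text \<open>The three cases are: no action, an error before the guessed one, and the guessed error.
  The bound \<open>u\<close> makes the relation decidable; it affects only whether the least
  extension is found, not which one it is.\<close>

definition step :: "nat \<Rightarrow> nat \<Rightarrow> (nat \<Rightarrow> nat) \<Rightarrow> nat \<Rightarrow> nat \<Rightarrow> nat \<Rightarrow> bool" where
  "step u i X p s s' \<longleftrightarrow>
     (\<not> attempt i X p s \<and> s' = pp (list_encode (out s @ [0])) (pr s)) \<or>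
     (attempt i X p s \<and> cnt s (pl p) < guess i X (pl p) \<and> s' = advance s (pl p) (out s) (out s)) \<or>
     (attempt i X p s \<and> cnt s (pl p) = guess i X (pl p) \<and>
       (\<exists>w<u. extends_by (pl p) (out s) w \<and> (\<forall>w'<w. \<not> extends_by (pl p) (out s) w') \<and>
          s' = advance s (pl p) (list_decode (pl w)) []))"

definition stuck :: "nat \<Rightarrow> (nat \<Rightarrow> nat) \<Rightarrow> nat \<Rightarrow> nat \<Rightarrow> bool" where
  "stuck i X p s \<longleftrightarrow> attempt i X p s \<and> cnt s (pl p) = guess i X (pl p) \<and>
     \<not> (\<exists>w. extends_by (pl p) (out s) w)"

inductive runs :: "nat \<Rightarrow> (nat \<Rightarrow> nat) \<Rightarrow> nat \<Rightarrow> nat \<Rightarrow> bool" for i X where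
  runs_0: "runs i X 0 0"
| runs_Suc: "runs i X p s \<Longrightarrow> step u i X p s s' \<Longrightarrow> runs i X (Suc p) s'"

section \<open>Determinism and monotonicity of runs\<close>

lemma nthd_advance:
  "nthd (list_decode (pr (advance s e \<tau> \<mu>))) j =
    (if j = e then pp (Suc (cnt s e)) (list_encode \<mu>) else nthd (list_decode (pr s)) j)"
  by (auto simp: advance_def nthd_def simp del: upt_Suc)

lemma advance_simps:
  "out (advance s e \<tau> \<mu>) = \<tau> @ [0]"
  "cnt (advance s e \<tau> \<mu>) j = (if j = e then Suc (cnt s e) else cnt s j)"
  "mark (advance s e \<tau> \<mu>) j = (if j = e then \<mu> else mark s j)"
  by (simp_all add: out_def cnt_def mark_def nthd_advance) (simp add: advance_def)

lemma step_cases: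
  assumes "step u i X p s s'"
  obtains
    (skip) "\<not> attempt i X p s" "out s' = out s @ [0]" "cnt s' = cnt s" "mark s' = mark s"
  | (wrong) "attempt i X p s" "cnt s (pl p) < guess i X (pl p)" "out s' = out s @ [0]"
      "cnt s' = (cnt s)(pl p := Suc (cnt s (pl p)))" "mark s' = (mark s)(pl p := out s)"
  | (win) w where "attempt i X p s" "cnt s (pl p) = guess i X (pl p)" "extends_by (pl p) (out s) w"
      "out s' = list_decode (pl w) @ [0]"
      "cnt s' = (cnt s)(pl p := Suc (cnt s (pl p)))" "mark s' = (mark s)(pl p := [])"
proof -
  consider "\<not> attempt i X p s" "s' = pp (list_encode (out s @ [0])) (pr s)"
    | "attempt i X p s" "cnt s (pl p) < guess i X (pl p)" "s' = advance s (pl p) (out s) (out s)"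
    | w where "attempt i X p s" "cnt s (pl p) = guess i X (pl p)" "extends_by (pl p) (out s) w"
      "s' = advance s (pl p) (list_decode (pl w)) []"
    using assms unfolding step_def by blast
  then show thesis
  proof cases
    case 1
    then show thesis by (intro skip) (auto simp: out_def cnt_def mark_def)
  next
    case 2
    then show thesis by (intro wrong) (auto simp: advance_simps)
  next
    case 3
    then show thesis by (intro win) (auto simp: advance_simps)
  qed
qed

lemma step_mono: "step u i X p s s' \<Longrightarrow> u \<le> u' \<Longrightarrow> step u' i X p s s'"
  unfolding step_def using less_le_trans by blast

lemma step_det:
  assumes "step u i X p s s1" "step u' i X p s s2" shows "s1 = s2"
proof -
  have "w = w'" if "extends_by e \<rho> w" "\<forall>v<w. \<not> extends_by e \<rho> v"
    "extends_by e \<rho> w'" "\<forall>v<w'. \<not> extends_by e \<rho> v" for e \<rho> w w'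
    using that by (metis linorder_neqE_nat)
  then show ?thesis using assms unfolding step_def by (metis less_irrefl)
qed

lemma step_ex:
  assumes "\<not> stuck i X p s" shows "\<exists>u s'. step u i X p s s'"
proof (cases "attempt i X p s \<and> cnt s (pl p) = guess i X (pl p)")
  case True
  then have "\<exists>w. extends_by (pl p) (out s) w" using assms unfolding stuck_def by blast
  then obtain w where "extends_by (pl p) (out s) w" "\<forall>w'<w. \<not> extends_by (pl p) (out s) w'"
    using exists_least_iff[of "extends_by (pl p) (out s)"] by blast
  then have "step (Suc w) i X p s (advance s (pl p) (list_decode (pl w)) [])"
    using True unfolding step_def by blast
  then show ?thesis by blast
next
  case False
  then show ?thesis unfolding step_def attempt_def by (metis le_neq_implies_less)
qed

lemma runs_det: "runs i X p s \<Longrightarrow> runs i X p s' \<Longrightarrow> s = s'"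
proof (induction arbitrary: s' rule: runs.induct)
  case runs_0
  then show ?case by (cases rule: runs.cases) auto
next
  case (runs_Suc p s u s1)
  from runs_Suc.prems obtain s0 u' where "runs i X p s0" "step u' i X p s0 s'"
    by (cases rule: runs.cases) auto
  with runs_Suc show ?case using step_det by blast
qed

lemma runs_prefix: "runs i X p s \<Longrightarrow> q \<le> p \<Longrightarrow> \<exists>s'. runs i X q s'"
  by (induction rule: runs.induct) (auto simp: le_Suc_eq intro: runs.intros)

lemma cnt_mono:
  "runs i X p s \<Longrightarrow> runs i X q t \<Longrightarrow> q \<le> p \<Longrightarrow> cnt t e \<le> cnt s e"
proof (induction arbitrary: t rule: runs.induct)
  case runs_0
  then show ?case using runs_det[OF runs.runs_0] by fastforce
next
  case (runs_Suc p s u s')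
  show ?case
  proof (cases "q = Suc p")
    case True
    then show ?thesis using runs_Suc runs_det[OF runs.runs_Suc[OF runs_Suc(1,2)]] by blast
  next
    case False
    then have "cnt t e \<le> cnt s e" using runs_Suc by simp
    also have "\<dots> \<le> cnt s' e" using runs_Suc(2) by (cases rule: step_cases) auto
    finally show ?thesis .
  qed
qed

lemma step_cong: "guess i X (pl p) = guess i Y (pl p) \<Longrightarrow> step u i X p s s' = step u i Y p s s'"
  by (simp add: step_def attempt_def)

lemma stuck_cong: "guess i X (pl p) = guess i Y (pl p) \<Longrightarrow> stuck i X p s = stuck i Y p s"
  by (simp add: stuck_def attempt_def)

lemma runs_cong:
  "runs i X p s \<Longrightarrow> (\<And>e. e \<le> p \<Longrightarrow> guess i X e = guess i Y e) \<Longrightarrow> runs i Y p s"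
proof (induction rule: runs.induct)
  case (runs_Suc p s u s')
  have "step u i Y p s s'" using runs_Suc step_cong[of i X p Y] pl_le[of p] by simp
  with runs_Suc show ?case by (auto intro: runs.runs_Suc)
qed (rule runs_0)

text \<open>Two inputs with different guesses for requirement \<open>e\<close> share a run until the smaller guess is
  used. If that guess is stuck, the other run has just recorded an inextensible mark, and it never
  attempts \<open>e\<close> again.\<close>

lemma stuck_guess_less:
  assumes off: "\<And>e'. e' \<noteq> e \<Longrightarrow> guess i X e' = guess i Y e'"
    and X: "runs i X p s" "stuck i X p s" "pl p = e"
    and Y: "runs i Y q t" "stuck i Y q t" "pl q = e"
  shows "\<not> guess i X e < guess i Y e"
proof
  assume less: "guess i X e < guess i Y e"
  have cs: "cnt s e = guess i X e" using X(2,3) by (simp add: stuck_def)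
  \<comment> \<open>Before stage \<open>p\<close> the \<open>X\<close>-run has no win at
    \<open>e\<close>, as that would push the count above \<open>guess i X e\<close>. So its count
    lies below both guesses at every attempt, and the two runs act alike.\<close>
  have same: "runs i Y q' t'" if "runs i X q' t'" "q' \<le> p" for q' t'
    using that
  proof (induction rule: runs.induct)
    case (runs_Suc q' t' u t'')
    have le: "cnt t' e \<le> guess i X e" "cnt t'' e \<le> guess i X e"
      using cnt_mono[OF X(1) runs_Suc(1), of e] cnt_mono[OF X(1) runs.runs_Suc[OF runs_Suc(1,2)], of e]
        runs_Suc.prems cs by simp_all
    have "step u i Y q' t' t''"
    proof (cases "pl q' = e")
      case True
      have "cnt t' e \<noteq> guess i X e" if "attempt i X q' t'"
        using runs_Suc(2) that le(2) True by (cases rule: step_cases) auto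
      then show ?thesis using runs_Suc(2) le less True unfolding step_def attempt_def by auto
    next
      case False
      then show ?thesis using runs_Suc(2) step_cong[OF off] by blast
    qed
    with runs_Suc show ?case by (auto intro: runs.runs_Suc)
  qed (rule runs_0)
  show False
  proof (cases "q \<le> p")
    case True
    obtain t' where "runs i X q t'" using runs_prefix[OF X(1) True] by blast
    then have "runs i X q t" using same[OF _ True] runs_det[OF Y(1)] by blast
    then have "cnt t e \<le> guess i X e" using cnt_mono[OF X(1) _ True] cs by metis
    then show False using Y(2,3) less by (simp add: stuck_def)
  next
    case False
    have "runs i Y p s" using same X(1) by blast
    \<comment> \<open>At stage \<open>p\<close> the \<open>Y\<close>-run still takes the error
      branch and records \<open>out s\<close>. Because \<open>X\<close> is stuck, this mark has no
      extension at all, so it is never refuted.\<close>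
    have "Suc p \<le> q \<Longrightarrow> runs i Y q t \<Longrightarrow> mark t e = out s" for q t
    proof (induction q arbitrary: t rule: dec_induct)
      case base
      then obtain s' u where "runs i Y p s'" "step u i Y p s' t" by (cases rule: runs.cases) auto
      then have "step u i Y p s t" using runs_det[OF \<open>runs i Y p s\<close>] by blast
      moreover have "attempt i Y p s" "cnt s (pl p) \<noteq> guess i Y (pl p)"
        using X(2,3) less unfolding stuck_def attempt_def by auto
      ultimately show ?case using X(3) by (cases rule: step_cases) auto
    next
      case (step q)
      from step.prems obtain t' u where t': "runs i Y q t'" "step u i Y q t' t"
        by (cases rule: runs.cases) auto
      have "mark t' e = out s" using step.IH t'(1) by blast
      then have no: "\<not> attempt i Y q t'" if "pl q = e"
        using X(2,3) that unfolding stuck_def attempt_def by auto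
      show ?case using t'(2) no \<open>mark t' e = out s\<close> by (cases rule: step_cases) auto
    qed
    then have "mark t e = out s" using Y(1) False by (meson not_less_eq_eq)
    then show False using X(2,3) Y(2,3) unfolding stuck_def attempt_def by auto
  qed
qed

section \<open>Finite use and the probability of getting stuck\<close>

lemma guess_inject: "guess i X e = guess i Y e \<longleftrightarrow> (\<forall>j\<le>e + i. X (pp e j) = Y (pp e j))"
  unfolding guess_def list_encode_eq by (auto simp: less_Suc_eq_le simp del: upt_Suc)

lemma pp_mono: "a \<le> c \<Longrightarrow> b \<le> d \<Longrightarrow> pp a b \<le> pp c d"
  unfolding prod_encode_def triangle_def
  by (simp, intro add_mono div_le_mono mult_le_mono) auto

text \<open>By monotonicity of pairing this exceeds every position in the blocks of requirements up
  to \<open>p\<close>, hence everything read through stage \<open>p\<close>.\<close>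

definition use_bound :: "nat \<Rightarrow> nat \<Rightarrow> nat" where
  "use_bound i p = Suc (pp p (p + i))"

lemma less_use_bound: "e \<le> p \<Longrightarrow> j \<le> e + i \<Longrightarrow> pp e j < use_bound i p"
  unfolding use_bound_def less_Suc_eq_le by (intro pp_mono) auto

lemma guess_restr: "e \<le> p \<Longrightarrow> use_bound i p \<le> n \<Longrightarrow> guess i (nthd (restr X n)) e = guess i X e"
  unfolding guess_inject by (meson less_use_bound less_le_trans nthd_restr)

lemma use_bound_mono: "p \<le> q \<Longrightarrow> use_bound i p \<le> use_bound i q"
  unfolding use_bound_def by (simp add: pp_mono)

definition lossy :: "nat \<Rightarrow> nat \<Rightarrow> (nat \<Rightarrow> nat) \<Rightarrow> nat \<Rightarrow> bool" where
  "lossy i e X p \<longleftrightarrow> pl p = e \<and> (\<exists>s. runs i X p s \<and> stuck i X p s)"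

lemma lossy_restr: "use_bound i p \<le> n \<Longrightarrow> lossy i e (nthd (restr X n)) p \<longleftrightarrow> lossy i e X p"
proof -
  assume n: "use_bound i p \<le> n"
  have g: "guess i (nthd (restr X n)) e' = guess i X e'" if "e' \<le> p" for e'
    using guess_restr[OF that n] .
  have "runs i (nthd (restr X n)) p s \<longleftrightarrow> runs i X p s" for s
    using g by (metis runs_cong)
  moreover have "stuck i (nthd (restr X n)) p s \<longleftrightarrow> stuck i X p s" for s
    by (rule stuck_cong) (rule g[OF pl_le])
  ultimately show ?thesis unfolding lossy_def by simp
qed

definition loss :: "nat \<Rightarrow> nat \<Rightarrow> (nat \<Rightarrow> nat) set" where
  "loss i e = {X \<in> cantor. \<exists>p. lossy i e X p}"

text \<open>Erasing the block of requirement \<open>e\<close> is injective on the losing strings: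
  the remaining bits determine all other guesses, and for these at most one guess at
  \<open>e\<close> can be stuck. The erased block has \<open>e + i + 1\<close> positions.\<close>

lemma card_lossy:
  "card (strings (use_bound i p) (\<lambda>\<sigma>. \<exists>q\<le>p. lossy i e (nthd \<sigma>) q)) * 2 ^ Suc (e + i) \<le> 2 ^ use_bound i p"
proof (cases "e \<le> p")
  case False
  have "strings (use_bound i p) (\<lambda>\<sigma>. \<exists>q\<le>p. lossy i e (nthd \<sigma>) q) = {}"
    unfolding strings_def lossy_def using False pl_le order.trans by blast
  then show ?thesis by (simp only: card.empty)
next
  case True
  define n where "n = use_bound i p"
  define D where "D = strings n (\<lambda>\<sigma>. \<exists>q\<le>p. lossy i e (nthd \<sigma>) q)"
  define B where "B = pp e ` {..e + i}"
  have B: "B \<subseteq> {..<n}" "card B = Suc (e + i)"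
    unfolding B_def n_def using less_use_bound[OF True]
    by (auto simp: card_image inj_on_def prod_encode_eq)
  let ?r = "\<lambda>\<sigma>. restrict (nthd \<sigma>) ({..<n} - B)"
  have "inj_on ?r D"
  proof (rule inj_onI)
    fix \<sigma> \<sigma>' assume \<sigma>: "\<sigma> \<in> D" "\<sigma>' \<in> D" and eq: "?r \<sigma> = ?r \<sigma>'"
    have len: "length \<sigma> = n" "length \<sigma>' = n" using \<sigma> by (auto simp: D_def strings_def)
    have off: "nthd \<sigma> x = nthd \<sigma>' x" if "x \<notin> B" for x
      using fun_cong[OF eq, of x] that len by (cases "x < n") (auto simp: nthd_def)
    have "guess i (nthd \<sigma>) e' = guess i (nthd \<sigma>') e'" if "e' \<noteq> e" for e'
      unfolding guess_inject by (intro allI impI off) (use that in \<open>auto simp: B_def prod_encode_eq\<close>)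
    then have "guess i (nthd \<sigma>) e = guess i (nthd \<sigma>') e"
    proof -
      obtain q s q' s' where
        1: "runs i (nthd \<sigma>) q s" "stuck i (nthd \<sigma>) q s" "pl q = e" and
        2: "runs i (nthd \<sigma>') q' s'" "stuck i (nthd \<sigma>') q' s'" "pl q' = e"
        using \<sigma> unfolding D_def strings_def lossy_def by blast
      note off = \<open>\<And>e'. e' \<noteq> e \<Longrightarrow> guess i (nthd \<sigma>) e' = guess i (nthd \<sigma>') e'\<close>
      show ?thesis
        using stuck_guess_less[OF off 1 2] stuck_guess_less[OF off[symmetric] 2 1] by simp
    qed
    then have "nthd \<sigma> x = nthd \<sigma>' x" if "x \<in> B" for x
      using that unfolding guess_inject by (auto simp: B_def)
    with off have "nthd \<sigma> x = nthd \<sigma>' x" for x by blast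
    then show "\<sigma> = \<sigma>'" using len by (intro nth_equalityI) (auto simp: nthd_def, metis)
  qed
  moreover have "?r ` D \<subseteq> ({..<n} - B) \<rightarrow>\<^sub>E {0, 1}"
  proof (intro image_subsetI restrict_PiE_iff[THEN iffD2] ballI)
    fix \<sigma> x assume "\<sigma> \<in> D" "x \<in> {..<n} - B"
    then have "x < length \<sigma>" "\<sigma> \<in> binary_strings" by (auto simp: D_def strings_def)
    moreover from this have "\<sigma> ! x \<in> {0, 1}" unfolding binary_strings_def using nth_mem by blast
    ultimately show "nthd \<sigma> x \<in> {0, 1}" by (simp add: nthd_def)
  qed
  ultimately have "card D \<le> card (({..<n} - B) \<rightarrow>\<^sub>E {0, 1::nat})"
    by (metis (no_types, lifting) card_image card_mono finite_PiE finite_Diff finite_lessThan finite.intros)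
  also have "\<dots> = 2 ^ (n - Suc (e + i))"
    using B by (simp add: card_PiE card_Diff_subset finite_subset[OF B(1)] numeral_2_eq_2)
  finally have "card D * 2 ^ Suc (e + i) \<le> 2 ^ (n - Suc (e + i)) * 2 ^ Suc (e + i)"
    by (rule mult_le_mono1)
  also have "\<dots> = 2 ^ n"
    using B card_mono[OF _ B(1)] by (subst power_add[symmetric]) simp
  finally show ?thesis unfolding D_def n_def .
qed

lemma loss_eq: "loss i e = (\<Union>p. level (use_bound i p) (\<lambda>\<sigma>. \<exists>q\<le>p. lossy i e (nthd \<sigma>) q))"
proof -
  have "(\<exists>q\<le>p. lossy i e (nthd (restr X (use_bound i p))) q) \<longleftrightarrow> (\<exists>q\<le>p. lossy i e X q)" for X p
    using lossy_restr[OF use_bound_mono, of _ p i e X] by blast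
  then show ?thesis unfolding loss_def level_def by auto
qed

lemma loss_sets: "loss i e \<in> sets coin_measure"
  unfolding loss_eq by (intro sets.countable_UN image_subsetI level_sets)

text \<open>Allowing all \<open>q \<le> p\<close> makes the levels increase with \<open>p\<close>,
  so the uniform bound from \<open>card_lossy\<close> passes to the limit.\<close>

lemma measure_loss: "measure coin_measure (loss i e) \<le> (1 / 2) ^ Suc (e + i)"
proof -
  let ?L = "\<lambda>p. level (use_bound i p) (\<lambda>\<sigma>. \<exists>q\<le>p. lossy i e (nthd \<sigma>) q)"
  have "incseq ?L"
  proof -
    have "(\<exists>q\<le>p. lossy i e (nthd (restr X (use_bound i p))) q) \<longleftrightarrow> (\<exists>q\<le>p. lossy i e X q)" for X p
      using lossy_restr[OF use_bound_mono, of _ p i e X] by blast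
    then show ?thesis unfolding incseq_def level_def using order.trans by simp blast
  qed
  then have "(\<lambda>p. measure coin_measure (?L p)) \<longlonglongrightarrow> measure coin_measure (loss i e)"
    unfolding loss_eq by (intro coin.finite_Lim_measure_incseq) auto
  moreover have "measure coin_measure (?L p) \<le> (1 / 2) ^ Suc (e + i)" for p
  proof -
    have "real (card (strings (use_bound i p) (\<lambda>\<sigma>. \<exists>q\<le>p. lossy i e (nthd \<sigma>) q)) * 2 ^ Suc (e + i)) \<le> real (2 ^ use_bound i p)"
      using card_lossy by (simp only: of_nat_le_iff)
    then show ?thesis unfolding measure_level power_one_over
      by (simp add: divide_simps del: power_Suc)
  qed
  ultimately show ?thesis by (intro LIMSEQ_le_const2) auto
qed

lemma measure_total_loss: "measure coin_measure (\<Union>e. loss i e) \<le> (1 / 2) ^ i"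
  by (rule measure_UN_le_sums[OF loss_sets _ half_power_sums])
    (use measure_loss[of i] in \<open>simp add: power_add mult.commute\<close>)

section \<open>Genericity of the limit\<close>

lemma step_out:
  assumes "step u i X p s s'"
  shows "\<exists>\<tau>. out s' = \<tau> @ [0] \<and> prefix (out s) \<tau> \<and> (out s \<in> binary_strings \<longrightarrow> \<tau> \<in> binary_strings)"
  using assms by (cases rule: step_cases) (auto simp: extends_by_def)

text \<open>The length bound makes the limit an infinite sequence; since marks are prefixes of the
  output, a mark that is never refuted is an initial segment of the limit.\<close>

lemma runs_invariants:
  "runs i X p s \<Longrightarrow> out s \<in> binary_strings \<and> p \<le> length (out s) \<and> (\<forall>e. prefix (mark s e) (out s))"
proof (induction rule: runs.induct)
  case runs_0
  have "pl 0 = 0" "pr 0 = 0" using pl_le[of 0] pr_le[of 0] by simp_all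
  then show ?case by (simp add: out_def mark_def binary_strings_def nthd_def)
next
  case (runs_Suc p s u s')
  obtain \<tau> where \<tau>: "out s' = \<tau> @ [0]" "prefix (out s) \<tau>" "\<tau> \<in> binary_strings"
    using step_out[OF runs_Suc(2)] runs_Suc(3) by blast
  have "prefix (mark s' e) (out s')" for e
  proof -
    have "mark s' e \<in> {mark s e, out s, []}"
      using runs_Suc(2) by (cases rule: step_cases) auto
    moreover have "prefix (out s) (out s')" using \<tau> by (simp add: prefix_append)
    moreover from this have "prefix (mark s e) (out s')"
      using runs_Suc(3) prefix_order.order_trans by blast
    ultimately show ?thesis by auto
  qed
  with \<tau> prefix_length_le[OF \<tau>(2)] runs_Suc(3) show ?case
    by (auto simp: binary_strings_def)
qed

lemma runs_out_prefix:
  "runs i X p s \<Longrightarrow> runs i X q t \<Longrightarrow> q \<le> p \<Longrightarrow> prefix (out t) (out s)"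
proof (induction arbitrary: t rule: runs.induct)
  case runs_0
  then show ?case using runs_det[OF runs.runs_0] by fastforce
next
  case (runs_Suc p s u s')
  show ?case
  proof (cases "q = Suc p")
    case True
    then show ?thesis using runs_Suc runs_det[OF runs.runs_Suc[OF runs_Suc(1,2)]] by blast
  next
    case False
    then have "prefix (out t) (out s)" using runs_Suc by simp
    also have "prefix (out s) (out s')" using step_out[OF runs_Suc(2)] by (auto simp: prefix_append)
    finally show ?thesis .
  qed
qed

lemma prefix_nthd: "prefix \<sigma> \<tau> \<Longrightarrow> x < length \<sigma> \<Longrightarrow> nthd \<sigma> x = nthd \<tau> x"
  by (auto simp: prefix_def nthd_def nth_append)

lemma bounded_mono_eventually_const:
  fixes a :: "nat \<Rightarrow> nat"
  assumes "\<And>p q. p \<le> q \<Longrightarrow> a p \<le> a q" "\<And>p. a p \<le> K"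
  shows "\<exists>p0. \<forall>p\<ge>p0. a p = a p0"
proof -
  obtain p0 where "\<forall>p. a p \<le> a p0" using ex_has_greatest_nat[of "\<lambda>_. True" 0 a "Suc K"] assms(2)
    by (auto simp: less_Suc_eq_le)
  then show ?thesis using assms(1) by (meson le_antisym)
qed

text \<open>If requirement \<open>e\<close> reaches its guessed error, the output is extended into
  \<open>S\<close>. Otherwise its count is bounded by the guess and settles, so the mark settles
  too; being checked infinitely often without refutation, it has no extension in
  \<open>S\<close>.\<close>

lemma limit_one_generic:
  assumes st: "\<And>p. runs i X p (st p)"
  shows "(\<lambda>y. nthd (out (st (Suc y))) y) \<in> one_generic"
proof -
  define G where "G y = nthd (out (st (Suc y))) y" for y
  have len: "p \<le> length (out (st p))" and bin: "out (st p) \<in> binary_strings"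
    and mk: "prefix (mark (st p) e) (out (st p))" for p e
    using runs_invariants[OF st] by auto
  have G: "G y = nthd (out (st p)) y" if "y < length (out (st p))" for y p
  proof -
    have y: "y < length (out (st (Suc y)))" using len[of "Suc y"] by simp
    show ?thesis
    proof (cases "p \<le> Suc y")
      case True
      then show ?thesis unfolding G_def
        using prefix_nthd[OF runs_out_prefix[OF st st True] that] by simp
    next
      case False
      then show ?thesis unfolding G_def
        using prefix_nthd[OF runs_out_prefix[OF st st] y, of p] by simp
    qed
  qed
  have pre: "restr G (length \<sigma>) = \<sigma>" if "prefix \<sigma> (out (st p))" for \<sigma> p
  proof (rule nth_equalityI)
    fix y assume "y < length (restr G (length \<sigma>))"
    then have y: "y < length \<sigma>" by simp
    then have "y < length (out (st p))" using prefix_length_le[OF that] by simp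
    then show "restr G (length \<sigma>) ! y = \<sigma> ! y"
      using G[of y p] prefix_nthd[OF that y] y by (simp add: restr_def nthd_def)
  qed simp
  have "G y \<in> {0, 1}" for y
  proof -
    have "y < length (out (st (Suc y)))" using len[of "Suc y"] by simp
    then have "out (st (Suc y)) ! y \<in> {0, 1}" "G y = out (st (Suc y)) ! y"
      using bin[of "Suc y"] nth_mem unfolding binary_strings_def G_def nthd_def by auto
    then show ?thesis by simp
  qed
  then have "G \<in> cantor" by (simp add: cantor_def image_subset_iff)
  moreover have "\<exists>k. restr G k \<in> S \<or> \<not> (\<exists>\<tau>\<in>S. prefix (restr G k) \<tau>)"
    if S: "S \<subseteq> binary_strings" "ce_strings S" for S
  proof -
    obtain e where e: "list_encode ` S = W_rel no_oracle e" using S(2) unfolding ce_strings_def by blast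
    have in_S: "\<tau> \<in> S \<longleftrightarrow> list_encode \<tau> \<in> W_rel no_oracle e" for \<tau>
      unfolding e[symmetric] by (auto simp: list_encode_eq)
    have ext: "(\<exists>w. extends_by e \<rho> w) \<longleftrightarrow> (\<exists>\<tau>\<in>S. prefix \<rho> \<tau>)" for \<rho>
    proof
      assume "\<exists>w. extends_by e \<rho> w"
      then obtain w where "prefix \<rho> (list_decode (pl w))" "halts_by e (pl w) (pr w)"
        unfolding extends_by_def by blast
      moreover from this(2) have "list_decode (pl w) \<in> S"
        unfolding in_S by (auto simp: W_iff_halts_by)
      ultimately show "\<exists>\<tau>\<in>S. prefix \<rho> \<tau>" by blast
    next
      assume "\<exists>\<tau>\<in>S. prefix \<rho> \<tau>"
      then obtain \<tau> where \<tau>: "\<tau> \<in> S" "prefix \<rho> \<tau>" by blast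
      then obtain w where "halts_by e (list_encode \<tau>) w" using in_S W_iff_halts_by by blast
      then have "extends_by e \<rho> (pp (list_encode \<tau>) w)"
        using \<tau> S(1) unfolding extends_by_def by auto
      then show "\<exists>w. extends_by e \<rho> w" by blast
    qed
    have step: "\<exists>u. step u i X p (st p) (st (Suc p))" for p
    proof -
      obtain s u where "runs i X p s" "step u i X p s (st (Suc p))"
        using st[of "Suc p"] by (cases rule: runs.cases) auto
      then show ?thesis using runs_det[OF st] by blast
    qed
    show ?thesis
    proof (cases "\<exists>p. pl p = e \<and> attempt i X p (st p) \<and> cnt (st p) e = guess i X e")
      case True
      then obtain p where p: "pl p = e" "attempt i X p (st p)" "cnt (st p) e = guess i X e" by blast
      obtain u where "step u i X p (st p) (st (Suc p))" using step by blast
      then obtain w where w: "extends_by e (out (st p)) w" "out (st (Suc p)) = list_decode (pl w) @ [0]"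
        by (cases rule: step_cases) (use p in auto)
      have "list_decode (pl w) \<in> S"
        using w(1) unfolding in_S extends_by_def by (auto simp: W_iff_halts_by)
      moreover have "restr G (length (list_decode (pl w))) = list_decode (pl w)"
        by (rule pre[of _ "Suc p"]) (simp add: w(2))
      ultimately show ?thesis by metis
    next
      case False
      then have no_win: "cnt (st p) e \<noteq> guess i X e" if "pl p = e" "attempt i X p (st p)" for p
        using that by blast
      \<comment> \<open>The count starts at \<open>0\<close> and could pass the guess only through a
        win.\<close>
      have le: "cnt (st p) e \<le> guess i X e" for p
      proof (induction p)
        case 0
        have "st 0 = 0" using runs_det[OF st runs_0] .
        moreover have "pl 0 = 0" "pr 0 = 0" using pl_le[of 0] pr_le[of 0] by simp_all
        ultimately show ?case by (simp add: cnt_def nthd_def)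
      next
        case (Suc p)
        obtain u where "step u i X p (st p) (st (Suc p))" using step by blast
        then show ?case using Suc no_win[of p] by (cases rule: step_cases) auto
      qed
      obtain p0 where p0: "\<And>p. p \<ge> p0 \<Longrightarrow> cnt (st p) e = cnt (st p0) e"
        using bounded_mono_eventually_const[of "\<lambda>p. cnt (st p) e"] le cnt_mono[OF st st] by metis
      have skip: "pl p = e \<longrightarrow> \<not> attempt i X p (st p)" "mark (st (Suc p)) e = mark (st p) e" if "p \<ge> p0" for p
      proof -
        obtain u where u: "step u i X p (st p) (st (Suc p))" using step by blast
        have c: "cnt (st (Suc p)) e = cnt (st p) e" using p0[of p] p0[of "Suc p"] that by linarith
        have "(pl p = e \<longrightarrow> \<not> attempt i X p (st p)) \<and> mark (st (Suc p)) e = mark (st p) e"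
        proof (cases rule: step_cases[OF u])
          case 1
          then show ?thesis by simp
        next
          case 2
          then have "pl p \<noteq> e" using c by (metis fun_upd_same n_not_Suc_n)
          then show ?thesis using 2(5) by simp
        next
          case (3 w)
          then have "pl p \<noteq> e" using c by (metis fun_upd_same n_not_Suc_n)
          then show ?thesis using 3(6) by simp
        qed
        then show "pl p = e \<longrightarrow> \<not> attempt i X p (st p)" "mark (st (Suc p)) e = mark (st p) e" by simp_all
      qed
      have mark: "mark (st p) e = mark (st p0) e" if "p \<ge> p0" for p
        using that by (induction rule: dec_induct) (simp_all add: skip(2))
      have "\<not> extends_by e (mark (st p0) e) w" for w
      proof -
        \<comment> \<open>A stage that serves \<open>e\<close>, comes after \<open>p0\<close>, and
          whose witness bound exceeds \<open>w\<close>.\<close>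
        let ?p = "pp e (p0 + w + 1)"
        have "?p \<ge> p0 + w + 1" by (rule le_pp2)
        then have "?p \<ge> p0" "w < ?p" by simp_all
        then show ?thesis using skip(1)[of ?p] le[of ?p] mark[of ?p] unfolding attempt_def by auto
      qed
      then have "\<not> (\<exists>\<tau>\<in>S. prefix (restr G (length (mark (st p0) e))) \<tau>)"
        unfolding pre[OF mk] using ext by blast
      then show ?thesis by blast
    qed
  qed
  ultimately show ?thesis unfolding one_generic_def G_def[abs_def] by blast
qed

section \<open>Computing the construction\<close>

text \<open>\<open>d\<close> pairs a table of the states at stages \<open>0\<close> to
  \<open>p\<close> with a search bound common to all steps. It turns the inductive
  \<open>runs\<close> into an unbounded search over a decidable relation.\<close>

definition history :: "nat \<Rightarrow> (nat \<Rightarrow> nat) \<Rightarrow> nat \<Rightarrow> nat \<Rightarrow> nat \<Rightarrow> bool" where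
  "history i X p s d \<longleftrightarrow> nthd (list_decode (pl d)) 0 = 0 \<and> nthd (list_decode (pl d)) p = s \<and>
     (\<forall>k<p. step (pr d) i X k (nthd (list_decode (pl d)) k) (nthd (list_decode (pl d)) (Suc k)))"

lemma runs_iff_history: "runs i X p s \<longleftrightarrow> (\<exists>d. history i X p s d)"
proof
  assume "runs i X p s"
  then have "\<exists>g u. g 0 = 0 \<and> g p = s \<and> (\<forall>k<p. step u i X k (g k) (g (Suc k)))"
  proof (induction rule: runs.induct)
    case runs_0
    then show ?case by (intro exI[of _ "\<lambda>_. 0"]) auto
  next
    case (runs_Suc p s u s')
    then obtain g u' where g: "g 0 = 0" "g p = s" "\<forall>k<p. step u' i X k (g k) (g (Suc k))" by blast
    \<comment> \<open>Enlarging the bounds preserves steps, so one bound can serve the whole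
      history.\<close>
    have "step (max u u') i X k ((g(Suc p := s')) k) ((g(Suc p := s')) (Suc k))" if "k < Suc p" for k
      using that g runs_Suc(2) by (auto simp: less_Suc_eq intro: step_mono)
    with g(1) show ?case by (intro exI[of _ "g(Suc p := s')"] exI[of _ "max u u'"]) auto
  qed
  then obtain g u where g: "g 0 = 0" "g p = s" "\<forall>k<p. step u i X k (g k) (g (Suc k))" by blast
  have "nthd (map g [0..<Suc p]) k = g k" if "k \<le> p" for k
    using that by (simp add: nthd_def del: upt_Suc)
  with g have "history i X p s (pp (list_encode (map g [0..<Suc p])) u)"
    unfolding history_def by (simp del: upt_Suc)
  then show "\<exists>d. history i X p s d" by blast
next
  assume "\<exists>d. history i X p s d"
  then obtain d where d: "history i X p s d" by blast
  let ?g = "nthd (list_decode (pl d))"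
  have "q \<le> p \<Longrightarrow> runs i X q (?g q)" for q
  proof (induction q)
    case 0
    then show ?case using d runs_0 unfolding history_def by simp
  next
    case (Suc q)
    have "step (pr d) i X q (?g q) (?g (Suc q))" using d Suc.prems unfolding history_def by simp
    with Suc show ?case using runs_Suc[of i X q "?g q"] by simp
  qed
  then show "runs i X p s" using d unfolding history_def by auto
qed

lemma dec_extends_by [cpt]:
  assumes "cpt E" "cptl R" "cpt W" shows "dec (\<lambda>f x. extends_by (E f x) (R f x) (W f x))"
  unfolding extends_by_def by (intro cpt assms)

lemma cpt_guess [cpt]:
  assumes "cpt I" "cptl S" "cpt E" shows "cpt (\<lambda>f x. guess (I f x) (nthd (S f x)) (E f x))"
  unfolding guess_def
  by (intro cpt assms cpt_comp[OF assms(3)] cptl_comp[OF assms(2)])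

lemma cptl_out [cpt]: "cpt A \<Longrightarrow> cptl (\<lambda>f x. out (A f x))"
  unfolding out_def by (intro cpt)

lemma cpt_cnt [cpt]: "cpt A \<Longrightarrow> cpt B \<Longrightarrow> cpt (\<lambda>f x. cnt (A f x) (B f x))"
  unfolding cnt_def by (intro cpt)

lemma cptl_mark [cpt]: "cpt A \<Longrightarrow> cpt B \<Longrightarrow> cptl (\<lambda>f x. mark (A f x) (B f x))"
  unfolding mark_def by (intro cpt)

lemma cpt_advance [cpt]:
  assumes "cpt S" "cpt E" "cptl T" "cptl M"
  shows "cpt (\<lambda>f x. advance (S f x) (E f x) (T f x) (M f x))"
  unfolding advance_def
  by (intro cpt assms cpt_comp[OF assms(1)] cpt_comp[OF assms(2)] cptl_comp[OF assms(4)])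

lemma dec_attempt [cpt]:
  assumes "cpt I" "cptl X" "cpt P" "cpt S"
  shows "dec (\<lambda>f x. attempt (I f x) (nthd (X f x)) (P f x) (S f x))"
  unfolding attempt_def
  by (intro cpt assms cpt_comp[OF assms(3)] cpt_comp[OF assms(4)])

lemma cptl_Nil [cpt]: "cptl (\<lambda>f x. [])"
  unfolding cptl_def by (intro cpt)

lemma dec_step [cpt]:
  assumes "cpt U" "cpt I" "cptl X" "cpt P" "cpt S" "cpt S'"
  shows "dec (\<lambda>f x. step (U f x) (I f x) (nthd (X f x)) (P f x) (S f x) (S' f x))"
  unfolding step_def
  by (intro cpt assms cpt_comp[OF assms(4)] cpt_comp[OF assms(5)] cpt_comp[OF assms(6)]
      cpt_comp[OF cpt_comp[OF assms(4)]] cpt_comp[OF cpt_comp[OF assms(5)]])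

lemma dec_history [cpt]:
  assumes "cpt I" "cptl X" "cpt P" "cpt S" "cpt D"
  shows "dec (\<lambda>f x. history (I f x) (nthd (X f x)) (P f x) (S f x) (D f x))"
  unfolding history_def
  by (intro cpt assms cpt_comp[OF assms(1)] cptl_comp[OF assms(2)] cpt_comp[OF assms(5)])

lemma cpt_use_bound [cpt]: "cpt A \<Longrightarrow> cpt B \<Longrightarrow> cpt (\<lambda>f x. use_bound (A f x) (B f x))"
  unfolding use_bound_def by (intro cpt)

text \<open>Value \<open>y\<close> is read from the state at stage \<open>Suc y\<close>, whose
  output has length at least \<open>Suc y\<close>. The search consults a finite part of the oracle
  of computable length, and \<open>smn\<close> makes the indices computable in
  \<open>i\<close>.\<close>

lemma limit_computable:
  obtains c where "\<And>i X st y. (\<And>p. runs i X p (st p)) \<Longrightarrow>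
    Phi (smn c i) X y = Some (nthd (out (st (Suc y))) y)"
proof -
  let ?P = "\<lambda>f x n. history (pl x) (nthd (restr f (use_bound (pl x) (Suc (pr x))))) (Suc (pr x)) (pl n) (pr n)"
  have "dec (\<lambda>f z. ?P f (pl z) (pr z))" "cpt (\<lambda>f z. nthd (out (pl (pr z))) (pr (pl z)))"
    by (intro cpt)+
  then obtain c where c: "\<forall>f x. Phi c f x =
      (if \<exists>n. ?P f x n then Some (nthd (out (pl (LEAST n. ?P f x n))) (pr x)) else None)"
    using mu_search[of ?P "\<lambda>f x n. nthd (out (pl n)) (pr x)"] by blast
  show thesis
  proof (rule that[of c])
    fix i X st y assume st: "\<And>p. runs i X p (st p)"
    have g: "guess i (nthd (restr X (use_bound i (Suc y)))) e = guess i X e" if "e \<le> Suc y" for e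
      using guess_restr[OF that order.refl] .
    have r: "runs i (nthd (restr X (use_bound i (Suc y)))) (Suc y) s \<longleftrightarrow> runs i X (Suc y) s" for s
      using g by (metis runs_cong)
    have val: "pl n = st (Suc y)" if "?P X (pp i y) n" for n
    proof -
      have "runs i X (Suc y) (pl n)" using that r runs_iff_history by auto
      then show ?thesis using runs_det[OF st] by metis
    qed
    obtain d where "history i (nthd (restr X (use_bound i (Suc y)))) (Suc y) (st (Suc y)) d"
      using st[of "Suc y"] r runs_iff_history by blast
    then have ex: "\<exists>n. ?P X (pp i y) n" by (intro exI[of _ "pp (st (Suc y)) d"]) simp
    have "pl (LEAST n. ?P X (pp i y) n) = st (Suc y)" using LeastI_ex[OF ex] by (rule val)
    then show "Phi (smn c i) X y = Some (nthd (out (st (Suc y))) y)"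
      using c ex by (simp add: Phi_smn)
  qed
qed

section \<open>Effectivity of the losses: the test and the classes\<close>

text \<open>A candidate \<open>q = \<langle>i, \<langle>\<sigma>, \<langle>p, \<langle>s, d\<rangle>\<rangle>\<rangle>\<rangle>\<close> says that on the finite input \<open>\<sigma>\<close> the
  construction waits at stage \<open>p\<close> for an extension; it is a loss if there is none.\<close>

definition waits :: "nat \<Rightarrow> bool" where
  "waits q \<longleftrightarrow> (let i = pl q; \<sigma> = list_decode (pl (pr q)); p = pl (pr (pr q)); s = pl (pr (pr (pr q)))
     in length \<sigma> = use_bound i p \<and> history i (nthd \<sigma>) p s (pr (pr (pr (pr q)))) \<and>
        attempt i (nthd \<sigma>) p s \<and> cnt s (pl p) = guess i (nthd \<sigma>) (pl p))"

definition granted :: "nat \<Rightarrow> nat \<Rightarrow> bool" where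
  "granted q w \<longleftrightarrow> extends_by (pl (pl (pr (pr q)))) (out (pl (pr (pr (pr q))))) w"

lemma dec_waits [cpt]: assumes "cpt A" shows "dec (\<lambda>f x. waits (A f x))"
  unfolding waits_def Let_def by (intro cpt assms)

lemma dec_granted [cpt]: assumes "cpt A" "cpt B" shows "dec (\<lambda>f x. granted (A f x) (B f x))"
  unfolding granted_def by (intro cpt assms)

text \<open>Splits a loss into the decidable \<open>waits\<close> and a single universal condition
  on \<open>w\<close>. This form serves both enumeration from the halting problem and the definition
  of the classes.\<close>

lemma ex_lossy_iff:
  "(\<exists>e p. lossy i e X p) \<longleftrightarrow>
   (\<exists>r. waits (pp i r) \<and> \<not> (\<exists>w. granted (pp i r) w) \<and> X \<in> cylinder (list_decode (pl r)))"
proof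
  assume "\<exists>e p. lossy i e X p"
  then obtain e p where "lossy i e X p" by blast
  then have "lossy i e (nthd (restr X (use_bound i p))) p" by (simp add: lossy_restr)
  then obtain s d where s: "history i (nthd (restr X (use_bound i p))) p s d" "stuck i (nthd (restr X (use_bound i p))) p s"
    unfolding lossy_def runs_iff_history by blast
  let ?r = "pp (list_encode (restr X (use_bound i p))) (pp p (pp s d))"
  have "waits (pp i ?r)" "\<not> (\<exists>w. granted (pp i ?r) w)" "X \<in> cylinder (list_decode (pl ?r))"
    using s by (simp_all add: waits_def granted_def stuck_def in_cylinder_iff)
  then show "\<exists>r. waits (pp i r) \<and> \<not> (\<exists>w. granted (pp i r) w) \<and> X \<in> cylinder (list_decode (pl r))" by blast
next
  assume "\<exists>r. waits (pp i r) \<and> \<not> (\<exists>w. granted (pp i r) w) \<and> X \<in> cylinder (list_decode (pl r))"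
  then obtain r where r: "waits (pp i r)" "\<not> (\<exists>w. granted (pp i r) w)" "X \<in> cylinder (list_decode (pl r))"
    by blast
  let ?p = "pl (pr r)" and ?s = "pl (pr (pr r))"
  have "list_decode (pl r) = restr X (use_bound i ?p)"
    using r(1,3) by (simp add: waits_def in_cylinder_iff Let_def)
  then have "lossy i (pl ?p) (nthd (restr X (use_bound i ?p))) ?p"
    using r(1,2) unfolding lossy_def stuck_def runs_iff_history
    by (auto simp: waits_def granted_def Let_def)
  then show "\<exists>e p. lossy i e X p" by (auto simp: lossy_restr)
qed

text \<open>Relative to the halting problem one can enumerate the strings of candidates that wait in
  vain; the measure bounds come from \<open>measure_total_loss\<close>.\<close>

lemma martin_loef_test_loss: "martin_loef_test halting_oracle (\<lambda>i. \<Union>e. loss i e)"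
proof -
  obtain g where g: "\<And>f x. x \<in> W_rel f g \<longleftrightarrow> (\<exists>w. granted (pl x) w)"
    using dec_ce[of "\<lambda>f x w. granted (pl x) w", OF dec_granted[OF cpt_pl[OF cpt_pl[OF cpt_id]] cpt_pr[OF cpt_id]]]
    by blast
  \<comment> \<open>Program \<open>smn g q\<close> ignores its input and halts iff candidate
    \<open>q\<close> is granted an extension, so its self-application answers the question.\<close>
  have h: "halting_oracle (smn g q) = 0 \<longleftrightarrow> \<not> (\<exists>w. granted q w)" for q
  proof -
    have "smn g q \<in> halting_set \<longleftrightarrow> smn g q \<in> W_rel no_oracle (smn g q)"
      by (simp add: halting_set_def W_rel_def)
    also have "\<dots> \<longleftrightarrow> (\<exists>w. granted q w)" by (simp add: W_smn g)
    finally show ?thesis by (simp add: halting_oracle_def)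
  qed
  let ?P = "\<lambda>f x n. waits (pp (pl x) (pp (pr x) n)) \<and> f (smn g (pp (pl x) (pp (pr x) n))) = 0"
  have "dec (\<lambda>f z. ?P f (pl z) (pr z))" by (intro cpt cpt_oracle)
  then obtain e where e: "\<And>f x. x \<in> W_rel f e \<longleftrightarrow> (\<exists>n. ?P f x n)" using dec_ce[of ?P] by blast
  have "(\<Union>e. loss i e) = open_generated {\<sigma>. pp i (list_encode \<sigma>) \<in> W_rel halting_oracle e}" for i
  proof -
    have "(\<Union>e. loss i e) = {X \<in> cantor. \<exists>e p. lossy i e X p}" by (auto simp: loss_def)
    also have "\<dots> = open_generated {\<sigma>. pp i (list_encode \<sigma>) \<in> W_rel halting_oracle e}"
    proof -
      have "(\<exists>r. waits (pp i r) \<and> \<not> (\<exists>w. granted (pp i r) w) \<and> X \<in> cylinder (list_decode (pl r))) \<longleftrightarrow>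
          (\<exists>\<sigma>. (\<exists>n. waits (pp i (pp (list_encode \<sigma>) n)) \<and> \<not> (\<exists>w. granted (pp i (pp (list_encode \<sigma>) n)) w)) \<and>
             X \<in> cylinder \<sigma>)" for X
        by (metis list_decode_inverse list_encode_inverse pl_pp pp_pl_pr)
      then show ?thesis unfolding open_generated_def e ex_lossy_iff by (simp add: h)
    qed
    finally show ?thesis .
  qed
  then show ?thesis using measure_total_loss unfolding martin_loef_test_def by blast
qed

text \<open>Each candidate yields uniformly a closed class: the cylinder of its string if it waits
  in vain, and the empty class otherwise. The complement of their union over all candidates for
  \<open>i\<close> is \<open>V i\<close>.\<close>

lemma lossless_uniformly_Pi:
  "\<exists>V. uniformly_Pi 2 V \<and> (\<forall>i X. X \<in> V i \<longleftrightarrow> \<not> (\<exists>e p. lossy i e X p))"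
proof -
  \<comment> \<open>Indices of the clopen sets to remove: \<open>3 * m\<close> is the cylinder of
    \<open>list_decode m\<close> and \<open>3 * (3 * m) + 1\<close> its complement. The complement
    is always removed, and the cylinder as well once the candidate fails.\<close>
  let ?P = "\<lambda>f x n. pr x = 3 * (3 * pl (pr (pl x))) + 1 \<or>
    (\<not> waits (pl x) \<or> granted (pl x) n) \<and> pr x = 3 * pl (pr (pl x))"
  have "dec (\<lambda>f z. ?P f (pl z) (pr z))" by (intro cpt)
  then obtain c where c: "\<And>f x. x \<in> W_rel f c \<longleftrightarrow> (\<exists>n. ?P f x n)" using dec_ce[of ?P] by blast
  have Cyl: "clopen_of (3 * m) = Cyl (list_decode m)" for m
    by (cases rule: clopen_of_cases[of "3 * m"]) auto
  have Neg: "clopen_of (3 * m + 1) = Neg (clopen_of m)" for m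
  proof -
    have "(3 * m + 1) div 3 = m" "(3 * m + 1) mod 3 = 1" by presburger+
    then show ?thesis by (cases rule: clopen_of_cases[of "3 * m + 1"]) auto
  qed
  have inner: "X \<in> Pi_class 1 (smn c q) \<longleftrightarrow>
      waits q \<and> \<not> (\<exists>w. granted q w) \<and> X \<in> cylinder (list_decode (pl (pr q)))" for X q
  proof -
    have W: "k \<in> W_rel no_oracle (smn c q) \<longleftrightarrow> k = 3 * (3 * pl (pr q)) + 1 \<or>
        (\<not> waits q \<or> (\<exists>w. granted q w)) \<and> k = 3 * pl (pr q)" for k
      unfolding W_smn c by auto
    have "X \<in> Pi_class 1 (smn c q) \<longleftrightarrow> (\<forall>k\<in>W_rel no_oracle (smn c q). X \<notin> clopen_sem (clopen_of k))"
      by simp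
    also have "\<dots> \<longleftrightarrow> X \<notin> clopen_sem (clopen_of (3 * (3 * pl (pr q)) + 1)) \<and>
        (\<not> waits q \<or> (\<exists>w. granted q w) \<longrightarrow> X \<notin> clopen_sem (clopen_of (3 * pl (pr q))))"
      unfolding Ball_def W by metis
    also have "\<dots> \<longleftrightarrow> waits q \<and> \<not> (\<exists>w. granted q w) \<and> X \<in> cylinder (list_decode (pl (pr q)))"
      unfolding Neg Cyl by auto
    finally show ?thesis .
  qed
  obtain v where v: "\<And>f x. x \<in> W_rel f v \<longleftrightarrow> (\<exists>n. pr x = smn c (pp (pl x) n))"
  proof -
    have "dec (\<lambda>f z. pr (pl z) = smn c (pp (pl (pl z)) (pr z)))" by (intro cpt)
    then show thesis using that dec_ce[of "\<lambda>f x n. pr x = smn c (pp (pl x) n)"] by blast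
  qed
  have "X \<in> Pi_class 2 (smn v i) \<longleftrightarrow> \<not> (\<exists>e p. lossy i e X p)" for i X
  proof -
    have P: "Pi_class 2 (smn v i) = - (\<Union>k\<in>W_rel no_oracle (smn v i). Pi_class 1 k)"
      unfolding numeral_2_eq_2 One_nat_def by (rule Pi_class.simps)
    have W: "k \<in> W_rel no_oracle (smn v i) \<longleftrightarrow> (\<exists>r. k = smn c (pp i r))" for k
      by (simp add: W_smn v)
    have "X \<in> Pi_class 2 (smn v i) \<longleftrightarrow> (\<forall>r. X \<notin> Pi_class 1 (smn c (pp i r)))"
      by (simp only: P Compl_iff UN_iff Bex_def W) blast
    then show ?thesis unfolding inner ex_lossy_iff by simp
  qed
  moreover have "computable (smn v)" by (intro computableI cpt)
  ultimately show ?thesis unfolding uniformly_Pi_def by (intro exI[of _ "\<lambda>i. Pi_class 2 (smn v i)"]) auto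
qed

text \<open>A 2-random input escapes some member of the loss test, hence lies in some
  \<open>V i\<close>. Without losses no stage is stuck, so the run goes on forever and its limit is
  computed by the index \<open>smn c i\<close>.\<close>

lemma uniform_reducible_2: "uniform_reducible 2 one_generic two_random"
proof -
  obtain V where V: "uniformly_Pi 2 V" "\<And>i X. X \<in> V i \<longleftrightarrow> \<not> (\<exists>e p. lossy i e X p)"
    using lossless_uniformly_Pi by blast
  obtain c where c: "\<And>i X st y. (\<And>p. runs i X p (st p)) \<Longrightarrow>
    Phi (smn c i) X y = Some (nthd (out (st (Suc y))) y)"
    using limit_computable by blast
  have "two_random \<subseteq> (\<Union>i. V i)"
  proof
    fix X assume "X \<in> two_random"
    then have X: "X \<in> cantor" "\<forall>U. martin_loef_test halting_oracle U \<longrightarrow> X \<notin> (\<Inter>n. U n)"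
      by (simp_all add: two_random_def martin_loef_random_def)
    have "X \<notin> (\<Inter>i. \<Union>e. loss i e)" by (rule mp[OF spec[OF X(2)] martin_loef_test_loss])
    with X(1) obtain i where "\<not> (\<exists>e p. lossy i e X p)" unfolding loss_def by blast
    then show "X \<in> (\<Union>i. V i)" using V(2) by blast
  qed
  moreover have "computable (smn c)" by (intro computableI cpt)
  moreover have "Phi_in (smn c i) X one_generic" if "X \<in> V i" for i X
  proof -
    have ns: "\<not> stuck i X p s" if "runs i X p s" for p s
      using \<open>X \<in> V i\<close> that unfolding V(2) lossy_def by blast
    have "\<exists>s. runs i X p s" for p
    proof (induction p)
      case (Suc p)
      then obtain s where "runs i X p s" by blast
      then show ?case using step_ex[OF ns] runs_Suc by blast
    qed (use runs_0 in blast)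
    then obtain st where st: "\<And>p. runs i X p (st p)" by metis
    show ?thesis
      unfolding Phi_in_def by (intro bexI[OF _ limit_one_generic[OF st]] allI c[OF st])
  qed
  ultimately show ?thesis unfolding uniform_reducible_def using V(1) by blast
qed

section \<open>The exact level of uniformity\<close>

theorem theorem5p9:
  "uniformity one_generic two_random = 2 \<and>
   reducible 2 one_generic two_random \<and>
   \<not> reducible 0 one_generic two_random \<and>
   \<not> reducible 1 one_generic two_random"
proof -
  have 2: "reducible 2 one_generic two_random"
    using uniform_reducible_2 by (simp add: reducible_def numeral_eq_enat)
  have not: "\<not> reducible (enat n) one_generic two_random" if "n \<le> 1" for n
    using not_uniform_reducible[OF that] by (simp add: reducible_def)
  have "uniformity one_generic two_random = 2"
    unfolding uniformity_def
  proof (rule Least_equality[where P = "\<lambda>k. reducible k one_generic two_random", OF 2])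
    fix k assume k: "reducible k one_generic two_random"
    show "2 \<le> k"
    proof (cases k)
      case (enat n)
      then have "\<not> n \<le> 1" using k not by blast
      then show ?thesis using enat by (simp add: numeral_eq_enat)
    qed simp
  qed
  with 2 not[of 0] not[of 1] show ?thesis by (simp add: zero_enat_def one_enat_def)
qed

end
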